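(* Let $H=-\Delta+|x|^2$ be the Hermite operator on $\mathbb{R}^n$, let $f\in L^2(\mathbb{R}^n)$, and let $u(x,s)=e^{-isH}f(x)$ be the solution of the Schrödinger equation $i\partial_s u(x,s)-Hu(x,s)=0$ with initial condition $u(x,0)=f(x)$. Suppose that for some $a,b>0$ and some fixed $s_0\in\mathbb{R}$, $$|f(x)|=O(e^{-a|x|^2}),\qquad |u(x,s_0)|=O(e^{-b|x|^2}).$$ Then $u=0$ on $\mathbb{R}^n\times\mathbb{R}$ whenever $ab\sin^2(2s_0)>\tfrac14$.
   Context: $\Delta$ is the standard Laplacian on $\mathbb{R}^n$; $H$ is the self-adjoint nonnegative operator on $L^2(\mathbb{R}^n)$ (Hermite operator), so $e^{-isH}$ is a unitary group. *)

theory Defs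
  imports "HOL-Analysis.Analysis"
begin

fun hermite_poly :: "nat \<Rightarrow> real \<Rightarrow> real" where
  "hermite_poly 0 x = 1"
| "hermite_poly (Suc 0) x = 2 * x"
| "hermite_poly (Suc (Suc k)) x =
     2 * x * hermite_poly (Suc k) x - 2 * real (Suc k) * hermite_poly k x"

text \<open>Normalised one-dimensional Hermite functions h_k (orthonormal basis of L^2(R)).\<close>
definition hermite_fun :: "nat \<Rightarrow> real \<Rightarrow> real" where
  "hermite_fun k x = hermite_poly k x * exp (- (x\<^sup>2) / 2) / sqrt (2 ^ k * fact k * sqrt pi)"

text \<open>Multi-dimensional Hermite functions Phi_alpha(x) = prod_i h_{alpha_i}(x_i);
  they form an orthonormal eigenbasis of H = -Delta + |x|^2 on L^2(R^n),
  with H Phi_alpha = (2|alpha| + n) Phi_alpha.\<close>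
definition hermite_multi :: "('n::finite \<Rightarrow> nat) \<Rightarrow> real ^ 'n \<Rightarrow> real" where
  "hermite_multi \<alpha> x = (\<Prod>i\<in>UNIV. hermite_fun (\<alpha> i) (x $ i))"

definition L2 :: "(real ^ 'n::finite \<Rightarrow> complex) \<Rightarrow> bool" where
  "L2 f \<longleftrightarrow> f \<in> borel_measurable lborel \<and> integrable lborel (\<lambda>x. (norm (f x))\<^sup>2)"

definition hermite_coeff :: "(real ^ 'n::finite \<Rightarrow> complex) \<Rightarrow> ('n \<Rightarrow> nat) \<Rightarrow> complex" where
  "hermite_coeff f \<alpha> = (LINT x|lborel. f x * complex_of_real (hermite_multi \<alpha> x))"

definition hermite_eigenvalue :: "('n::finite \<Rightarrow> nat) \<Rightarrow> real" where
  "hermite_eigenvalue \<alpha> = 2 * real (\<Sum>i\<in>UNIV. \<alpha> i) + real CARD('n)"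

text \<open>u(.,s) = e^{-isH} f, defined through the spectral decomposition of H in the
  Hermite basis: u(.,s) is in L^2 and its Hermite coefficients are
  e^{-is(2|alpha|+n)} <f,Phi_alpha>.  (Determines u(.,s) a.e. by completeness.)\<close>
definition hermite_schroedinger :: "(real ^ 'n::finite \<Rightarrow> complex) \<Rightarrow> (real ^ 'n \<Rightarrow> real \<Rightarrow> complex) \<Rightarrow> bool" where
  "hermite_schroedinger f u \<longleftrightarrow>
     L2 f \<and> (\<forall>s. L2 (\<lambda>x. u x s) \<and>
       (\<forall>\<alpha>. hermite_coeff (\<lambda>x. u x s) \<alpha> =
              exp (- \<i> * complex_of_real (s * hermite_eigenvalue \<alpha>)) * hermite_coeff f \<alpha>))"

end

theory Submission
  imports Defs "HOL-Complex_Analysis.Complex_Analysis" "HOL-Probability.Distributions"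
begin

text \<open>The Bargmann transform turns \<open>exp (-isH)\<close> into the rotation \<open>z \<mapsto> exp (-2is) z\<close> (times a constant of modulus
  one), because it maps Hermite functions to monomials. On a complex line \<open>\<zeta> \<mapsto> \<zeta> \<omega>\<close> with \<open>\<omega>\<close> a real unit vector,
  the Gaussian decay of \<open>f\<close> becomes the bound \<open>exp (p \<bar>\<zeta>\<bar>\<^sup>2 - q Re \<zeta>\<^sup>2)\<close> with \<open>p = 1 / (2a + 1)\<close>, \<open>q = 2a / (2a + 1)\<close>,
  and the decay of \<open>u(\<cdot>, s0)\<close> gives the analogous bound in a rotated variable. In terms of \<open>\<zeta>\<^sup>2\<close>, the indicator
  diagram of the transform lies in two discs, which are disjoint exactly when \<open>a b sin\<^sup>2 (2 s0) > 1/4\<close>. A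
  Phragmen-Lindelof argument then shows that the transform vanishes, and so does \<open>f\<close>, since the transform on
  \<open>i \<real>\<^sup>n\<close> is a Fourier transform.\<close>

text \<open>The decay of \<open>f\<close> and the decay of \<open>u\<close> at time
  \<open>s0\<close> concern different functions and cannot be compared directly; after the transform
  both are bounds on one entire function, at the price of a rotation of the variable. Lines in real
  directions suffice because they cover \<open>i R^n\<close>, and on them the modulus of the kernel
  is a Gaussian in \<open>x\<close> with a real linear term, so that the decay can be integrated
  exactly. A bound \<open>exp (p |z|^2 - Re (c z^2))\<close> grows in the direction of
  \<open>z^2\<close> like the support function of a disc of radius \<open>p\<close>, centred at
  \<open>-c\<close> up to conjugation. The time \<open>s0\<close> enters only by carrying the second
  centre around a circle, by the angle \<open>4 s0\<close>. If \<open>sin (2 s0) = 0\<close>, both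
  centres are real and the discs overlap. If \<open>s0 = pi / 4\<close>, the evolution is the
  Fourier transform up to a constant and the statement is Hardy's uncertainty principle. The strict
  inequality in the hypothesis is a positive gap between the discs, and this gap supplies the decay
  near both axes.\<close>

section \<open>Entire functions of order two\<close>

text \<open>Order two is critical for a quadrant. But both bounds decay strictly near the axes, which leaves a
  sector of opening less than \<open>pi / 2\<close>, where \<open>exp (- \<eta> z\<^sup>\<rho>)\<close> with \<open>\<rho> > 2\<close> beats \<open>\<phi>\<close>. The substitution
  \<open>z = exp w\<close> turns the truncated sector into a rectangle.\<close>
lemma entire_bounded_in_quadrant:
  fixes \<phi> :: "complex \<Rightarrow> complex"
  assumes hol: "\<phi> holomorphic_on UNIV" and "\<delta> > 0" "M > 0"
    and b1: "\<And>z. norm (\<phi> z) \<le> C * exp (M * (Im z)\<^sup>2 - \<delta> * (Re z)\<^sup>2)"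
    and b2: "\<And>z. norm (\<phi> z) \<le> C * exp (M * (Re z)\<^sup>2 - \<delta> * (Im z)\<^sup>2)"
    and z: "Re z \<ge> 0" "Im z \<ge> 0"
  shows "norm (\<phi> z) \<le> C * exp M"
proof (cases "norm z \<le> 1")
  have "norm (\<phi> 0) \<le> C" using b1[of 0] by simp
  then have C: "C \<ge> 0" using norm_ge_zero order_trans by blast
  {
    case True
    have "\<bar>Im z\<bar> \<le> 1" using abs_Im_le_cmod[of z] True by linarith
    then have "M * (Im z)\<^sup>2 - \<delta> * (Re z)\<^sup>2 \<le> M * 1 - 0"
      using assms(2,3) by (intro diff_mono mult_left_mono) (auto simp: abs_square_le_1)
    then show ?thesis
      using order_trans[OF b1[of z]] C by (smt (verit) exp_le_cancel_iff mult_left_mono)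
  next
    case False
    \<comment> \<open>At angle \<open>t\<close> from an axis the exponent is \<open>|z|^2\<close>
      times \<open>M sin^2 t - \<delta> cos^2 t\<close>, which is nonpositive once
      \<open>sin^2 t\<close> is at most \<open>\<delta> / (M + \<delta>)\<close>;
      \<open>sin t \<le> t\<close> turns this into a bound on \<open>t\<close>. The cap
      \<open>pi / 8\<close> leaves a nonempty sector in the middle.\<close>
    define \<theta> where "\<theta> = min (sqrt (\<delta> / (M + \<delta>))) (pi / 8)"
    have \<theta>: "0 < \<theta>" "\<theta> \<le> pi / 8"
      using assms(2,3) by (auto simp: \<theta>_def)
    have sin_small: "M * (sin t)\<^sup>2 - \<delta> * (cos t)\<^sup>2 \<le> 0" if "0 \<le> t" "t \<le> \<theta>" for t
    proof -
      have "t \<le> sqrt (\<delta> / (M + \<delta>))" using that by (auto simp: \<theta>_def)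
      moreover have "0 \<le> sin t" using that \<theta> pi_gt_zero by (intro sin_ge_zero) linarith+
      moreover have "sin t \<le> t" using that by (simp add: sin_x_le_x)
      ultimately have "(sin t)\<^sup>2 \<le> (sqrt (\<delta> / (M + \<delta>)))\<^sup>2"
        by (intro power_mono) auto
      also have "\<dots> = \<delta> / (M + \<delta>)" using assms(2,3) by simp
      finally have "(M + \<delta>) * (sin t)\<^sup>2 \<le> \<delta>"
        using assms(2,3) by (simp add: field_simps)
      then show ?thesis by (simp add: cos_squared_eq algebra_simps)
    qed
    have low: "norm (\<phi> (exp w)) \<le> C" if "0 \<le> Im w" "Im w \<le> \<theta>" for w
    proof -
      have "M * (Im (exp w))\<^sup>2 - \<delta> * (Re (exp w))\<^sup>2 = (exp (Re w))\<^sup>2 * (M * (sin (Im w))\<^sup>2 - \<delta> * (cos (Im w))\<^sup>2)"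
        by (simp add: Re_exp Im_exp power_mult_distrib algebra_simps)
      also have "\<dots> \<le> 0" using sin_small[OF that] by (intro mult_nonneg_nonpos) auto
      finally have "exp (M * (Im (exp w))\<^sup>2 - \<delta> * (Re (exp w))\<^sup>2) \<le> 1" by simp
      then show ?thesis using order_trans[OF b1[of "exp w"]] C
        by (metis mult.right_neutral mult_left_mono)
    qed
    have high: "norm (\<phi> (exp w)) \<le> C" if "pi / 2 - \<theta> \<le> Im w" "Im w \<le> pi / 2" for w
    proof -
      have "M * (Re (exp w))\<^sup>2 - \<delta> * (Im (exp w))\<^sup>2
        = (exp (Re w))\<^sup>2 * (M * (sin (pi / 2 - Im w))\<^sup>2 - \<delta> * (cos (pi / 2 - Im w))\<^sup>2)"
        by (simp add: Re_exp Im_exp power_mult_distrib sin_diff cos_diff algebra_simps)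
      also have "\<dots> \<le> 0" using sin_small[of "pi / 2 - Im w"] that by (intro mult_nonneg_nonpos) auto
      finally have "exp (M * (Re (exp w))\<^sup>2 - \<delta> * (Im (exp w))\<^sup>2) \<le> 1" by simp
      then show ?thesis using order_trans[OF b2[of "exp w"]] C
        by (metis mult.right_neutral mult_left_mono)
    qed
    define w where "w = Ln z"
    have "z \<noteq> 0" using False by auto
    have ew: "exp w = z" using \<open>z \<noteq> 0\<close> by (simp add: w_def)
    have Imw: "0 \<le> Im w" "Im w \<le> pi / 2"
      using z \<open>z \<noteq> 0\<close> Im_Ln_pos_le[of z] Re_Ln_pos_le[of z] by (auto simp: w_def)
    have Rew: "Re w > 0" using False \<open>z \<noteq> 0\<close> by (simp add: w_def)
    have CM: "C \<le> C * exp M" using C assms(3) by (simp add: mult_le_cancel_left1)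
    consider "Im w \<le> \<theta>" | "pi / 2 - \<theta> \<le> Im w" | "\<theta> < Im w" "Im w < pi / 2 - \<theta>" by linarith
    then show ?thesis
    proof cases
      case 1
      then show ?thesis using low[of w] Imw CM ew by auto
    next
      case 2
      then show ?thesis using high[of w] Imw CM ew by auto
    next
      case 3
      \<comment> \<open>The cosine of \<open>\<rho> * (t - pi / 4)\<close> vanishes exactly half-way
        into the two good sectors, at \<open>\<theta> / 2\<close> and
        \<open>pi / 2 - \<theta> / 2\<close>. Hence it is at least \<open>\<kappa> > 0\<close> on
        the remaining sector, while \<open>\<theta> > 0\<close> still makes \<open>\<rho>\<close>
        exceed 2.\<close>
      define \<rho> where "\<rho> = (pi / 2) / (pi / 4 - \<theta> / 2)"
      define \<kappa> where "\<kappa> = cos (\<rho> * (pi / 4 - \<theta>))"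
      have den: "pi / 4 - \<theta> / 2 > 0" "pi / 4 - \<theta> > 0" using \<theta> pi_gt_zero by linarith+
      have \<rho>: "\<rho> > 2" using den \<theta> by (simp add: \<rho>_def field_simps)
      have "\<rho> * (pi / 4 - \<theta>) < \<rho> * (pi / 4 - \<theta> / 2)" using \<rho> \<theta> by (intro mult_strict_left_mono) auto
      also have "\<dots> = pi / 2" using den by (metis \<rho>_def nonzero_eq_divide_eq less_irrefl)
      finally have lt: "\<rho> * (pi / 4 - \<theta>) < pi / 2" .
      have ge: "\<rho> * (pi / 4 - \<theta>) \<ge> 0" using \<rho> den by simp
      have \<kappa>: "\<kappa> > 0" unfolding \<kappa>_def using lt ge by (intro cos_gt_zero_pi) auto
      have cos_ge: "cos (\<rho> * (t - pi / 4)) \<ge> \<kappa>" if "\<theta> \<le> t" "t \<le> pi / 2 - \<theta>" for t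
      proof -
        have "\<bar>\<rho> * (t - pi / 4)\<bar> \<le> \<rho> * (pi / 4 - \<theta>)"
          using that \<rho> by (auto simp: abs_mult intro!: mult_left_mono)
        then have "cos (\<rho> * (pi / 4 - \<theta>)) \<le> cos \<bar>\<rho> * (t - pi / 4)\<bar>"
          using lt pi_gt_zero by (subst cos_mono_le_eq) linarith+
        then show ?thesis by (simp add: \<kappa>_def)
      qed
      have main: "norm (\<phi> z) \<le> C * exp M * exp (\<eta> * exp (\<rho> * Re w))" if "\<eta> > 0" for \<eta>
      proof -
        \<comment> \<open>Subtracting \<open>\<i> * of_real (pi / 4)\<close> centres the damping
          power at the bisector of the quadrant, where its real part is largest.\<close>
        define h where "h = (\<lambda>\<zeta>. \<phi> (exp \<zeta>) * exp (- of_real \<eta> * exp (of_real \<rho> * (\<zeta> - \<i> * of_real (pi / 4)))))"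
        have holh: "h holomorphic_on S" for S
          unfolding h_def
          by (intro holomorphic_intros holomorphic_on_compose_gen[OF _ hol, unfolded o_def]) auto
        have nh: "norm (h \<zeta>) = norm (\<phi> (exp \<zeta>)) * exp (- \<eta> * exp (\<rho> * Re \<zeta>) * cos (\<rho> * (Im \<zeta> - pi / 4)))" for \<zeta>
          by (simp add: h_def norm_mult Re_exp)
        \<comment> \<open>On the right side of the rectangle the damping
          \<open>\<eta> * \<kappa> * exp (\<rho> * R)\<close> must beat the growth
          \<open>M * exp (2 * R)\<close>; solving for \<open>R\<close> gives the logarithm. The
          maximum with \<open>Re w\<close> keeps \<open>w\<close> inside.\<close>
        define R where "R = max (Re w) (ln (M / (\<eta> * \<kappa>) + 1) / (\<rho> - 2))"
        have pos: "M / (\<eta> * \<kappa>) > 0" using assms(3) that \<kappa> by simp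
        have "ln (M / (\<eta> * \<kappa>) + 1) / (\<rho> - 2) \<le> R" by (simp add: R_def)
        then have "ln (M / (\<eta> * \<kappa>) + 1) \<le> (\<rho> - 2) * R" using \<rho> by (simp add: field_simps)
        then have "M / (\<eta> * \<kappa>) + 1 \<le> exp ((\<rho> - 2) * R)" using pos
          by (metis add_pos_pos exp_le_cancel_iff exp_ln zero_less_one)
        then have "M \<le> \<eta> * \<kappa> * exp ((\<rho> - 2) * R)" using that \<kappa>
          by (simp add: field_simps) (smt (verit) mult_pos_pos)
        then have "M * exp (2 * R) \<le> \<eta> * \<kappa> * exp ((\<rho> - 2) * R) * exp (2 * R)"
          by (intro mult_right_mono) auto
        then have R: "M * exp (2 * R) \<le> \<eta> * \<kappa> * exp (\<rho> * R)"
          by (simp add: mult.assoc algebra_simps flip: exp_add)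
        let ?S = "cbox (Complex 0 \<theta>) (Complex R (pi / 2 - \<theta>))"
        have R0: "R > 0" "Re w \<le> R" using Rew by (auto simp: R_def)
        have "norm (h w) \<le> C * exp M"
        proof (rule maximum_modulus_frontier[of h ?S])
          show "h holomorphic_on interior ?S" by (rule holh)
          show "continuous_on (closure ?S) h" by (intro holomorphic_on_imp_continuous_on holh)
          show "bounded ?S" by simp
          show "w \<in> ?S" using 3 Rew R0 by (auto simp: in_cbox_complex_iff)
          fix \<zeta> assume "\<zeta> \<in> frontier ?S"
          then have mem: "\<zeta> \<in> ?S" "\<zeta> \<notin> box (Complex 0 \<theta>) (Complex R (pi / 2 - \<theta>))"
            by (auto simp: frontier_def)
          then have I: "\<theta> \<le> Im \<zeta>" "Im \<zeta> \<le> pi / 2 - \<theta>" and "0 \<le> Re \<zeta>" "Re \<zeta> \<le> R"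
            by (auto simp: in_cbox_complex_iff)
          have cos: "cos (\<rho> * (Im \<zeta> - pi / 4)) \<ge> \<kappa>" by (rule cos_ge[OF I])
          have "- \<eta> * exp (\<rho> * Re \<zeta>) * cos (\<rho> * (Im \<zeta> - pi / 4)) \<le> - \<eta> * exp (\<rho> * Re \<zeta>) * \<kappa>"
            using cos that by (intro mult_left_mono_neg) auto
          then have nh': "norm (h \<zeta>) \<le> norm (\<phi> (exp \<zeta>)) * exp (- \<eta> * exp (\<rho> * Re \<zeta>) * \<kappa>)"
            unfolding nh by (intro mult_left_mono) auto
          have neg: "- \<eta> * exp (\<rho> * Re \<zeta>) * \<kappa> \<le> 0" using that \<kappa> by simp
          have le: "norm (h \<zeta>) \<le> norm (\<phi> (exp \<zeta>))"
            using nh' neg by (smt (verit) exp_le_one_iff mult_left_le norm_ge_zero)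
          have gen: "norm (\<phi> (exp \<zeta>)) \<le> C * exp (M * exp (2 * Re \<zeta>))"
          proof -
            have le_norm: "M * (Im v)\<^sup>2 - \<delta> * (Re v)\<^sup>2 \<le> M * (norm v)\<^sup>2" for v
              using mult_nonneg_nonneg[OF less_imp_le zero_le_power2, of M "Re v"]
                mult_nonneg_nonneg[OF less_imp_le zero_le_power2, of \<delta> "Re v"] assms(2,3)
              unfolding cmod_power2 distrib_left by linarith
            have "C * exp (M * (Im (exp \<zeta>))\<^sup>2 - \<delta> * (Re (exp \<zeta>))\<^sup>2) \<le> C * exp (M * (norm (exp \<zeta>))\<^sup>2)"
              by (intro mult_left_mono iffD2[OF exp_le_cancel_iff] le_norm C)
            also have "(norm (exp \<zeta>))\<^sup>2 = exp (2 * Re \<zeta>)"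
              by (simp flip: exp_double)
            finally show ?thesis using b1[of "exp \<zeta>"] by linarith
          qed
          \<comment> \<open>The left side corresponds to an arc of the unit circle, which is where
            the factor \<open>exp M\<close> of the conclusion arises. On the right side the choice
            of \<open>R\<close> helps, and the horizontal sides lie on the borders of the good
            sectors.\<close>
          consider "Re \<zeta> = 0" | "Re \<zeta> = R" | "Im \<zeta> = \<theta>" | "Im \<zeta> = pi / 2 - \<theta>"
            using mem by (force simp: in_cbox_complex_iff in_box_complex_iff)
          then show "norm (h \<zeta>) \<le> C * exp M"
          proof cases
            case 1
            then show ?thesis using le gen by simp
          next
            case 2
            have "norm (h \<zeta>) \<le> C * exp (M * exp (2 * Re \<zeta>)) * exp (- \<eta> * exp (\<rho> * Re \<zeta>) * \<kappa>)"
              using nh' gen by (smt (verit) exp_gt_zero mult_right_mono)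
            also have "\<dots> = C * exp (M * exp (2 * R) - \<eta> * \<kappa> * exp (\<rho> * R))"
              by (simp add: 2 mult.assoc algebra_simps flip: exp_add)
            also have "\<dots> \<le> C * exp M" using R C assms(3) by (intro mult_left_mono) auto
            finally show ?thesis .
          next
            case 3
            then show ?thesis using low[of \<zeta>] le CM \<theta> by auto
          next
            case 4
            then show ?thesis using high[of \<zeta>] le CM \<theta> by auto
          qed
        qed
        moreover have "norm (\<phi> z) * exp (- \<eta> * exp (\<rho> * Re w)) \<le> norm (h w)"
          unfolding nh ew using that by (intro mult_left_mono) auto
        ultimately have "norm (\<phi> z) * exp (- (\<eta> * exp (\<rho> * Re w))) \<le> C * exp M" by simp
        then show ?thesis by (simp add: exp_minus field_simps)
      qed
      have "((\<lambda>\<eta>. C * exp M * exp (\<eta> * exp (\<rho> * Re w))) \<longlongrightarrow> C * exp M * exp (0 * exp (\<rho> * Re w))) (at_right 0)"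
        by (intro tendsto_intros)
      moreover have "eventually (\<lambda>\<eta>. norm (\<phi> z) \<le> C * exp M * exp (\<eta> * exp (\<rho> * Re w))) (at_right 0)"
        using eventually_at_right_less[of 0] by eventually_elim (rule main)
      ultimately have "norm (\<phi> z) \<le> C * exp M * exp (0 * exp (\<rho> * Re w))"
        by (intro tendsto_lowerbound) auto
      then show ?thesis by simp
    qed
  }
qed

text \<open>Multiplication by a power of \<open>\<i>\<close> carries any quadrant to the first one
  and either keeps or exchanges the two bounds. So \<open>\<phi>\<close> is bounded, hence constant
  by Liouville, and the decay along the real axis makes the constant zero.\<close>

lemma entire_eq_0:
  fixes \<phi> :: "complex \<Rightarrow> complex"
  assumes hol: "\<phi> holomorphic_on UNIV" and "\<delta> > 0" "M > 0"
    and b1: "\<And>z. norm (\<phi> z) \<le> C * exp (M * (Im z)\<^sup>2 - \<delta> * (Re z)\<^sup>2)"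
    and b2: "\<And>z. norm (\<phi> z) \<le> C * exp (M * (Re z)\<^sup>2 - \<delta> * (Im z)\<^sup>2)"
  shows "\<phi> z = 0"
proof -
  have hc: "(\<lambda>z. \<phi> (c * z)) holomorphic_on UNIV" for c
    by (intro holomorphic_on_compose_gen[OF _ hol, unfolded o_def] holomorphic_intros) auto
  have bound: "norm (\<phi> z) \<le> C * exp M" for z
  proof -
    have q: "norm (\<phi> (c * w)) \<le> C * exp M" if "c \<in> {1, -1, \<i>, -\<i>}" "Re w \<ge> 0" "Im w \<ge> 0" for c w
      by (rule entire_bounded_in_quadrant[OF hc assms(2,3) _ _ that(2,3), of c])
        (use that(1) b1[of "c * z" for z] b2[of "c * z" for z] in auto)
    consider "Re z \<ge> 0" "Im z \<ge> 0" | "Re z \<ge> 0" "Im z \<le> 0" | "Re z \<le> 0" "Im z \<ge> 0" | "Re z \<le> 0" "Im z \<le> 0"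
      by linarith
    then show ?thesis
    proof cases
      case 1 then show ?thesis using q[of 1 z] by simp
    next
      case 2 then show ?thesis using q[of "-\<i>" "\<i> * z"] by simp
    next
      case 3 then show ?thesis using q[of "\<i>" "-\<i> * z"] by simp
    next
      case 4 then show ?thesis using q[of "-1" "-z"] by simp
    qed
  qed
  then have "bounded (range \<phi>)" by (auto simp: bounded_iff)
  then obtain c where c: "\<And>z. \<phi> z = c"
    using Liouville_theorem[OF hol] by (auto simp: constant_on_def)
  have "norm c \<le> C * exp (- \<delta> * (real n)\<^sup>2)" for n
    using b1[of "of_nat n"] by (simp add: c)
  moreover have "(\<lambda>n. C * exp (- \<delta> * (real n)\<^sup>2)) \<longlonglongrightarrow> 0"
    using assms(2) by real_asymp
  ultimately have "norm c \<le> 0"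
    by (intro LIMSEQ_le_const) auto
  then show ?thesis by (simp add: c)
qed

text \<open>In the variable \<open>z\<^sup>2\<close> the hypotheses place the indicator diagram of \<open>\<phi>\<close> in two discs of radii \<open>p\<close>, \<open>p'\<close>
  whose centres have distance \<open>norm (c' - c)\<close>. A factor \<open>exp (\<kappa> z\<^sup>2)\<close> and a rotation put them on either side
  of the imaginary axis.\<close>
lemma entire_eq_0_disjoint_discs:
  fixes \<phi> :: "complex \<Rightarrow> complex"
  assumes hol: "\<phi> holomorphic_on UNIV" and "p > 0" "p' > 0" and c: "norm (c' - c) > p + p'"
    and b1: "\<And>z. norm (\<phi> z) \<le> C * exp (p * (norm z)\<^sup>2 - Re (c * z\<^sup>2))"
    and b2: "\<And>z. norm (\<phi> z) \<le> C' * exp (p' * (norm z)\<^sup>2 - Re (c' * z\<^sup>2))"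
  shows "\<phi> z = 0"
proof -
  define d where "d = c' - c"
  \<comment> \<open>Half the gap between the discs. The point \<open>\<kappa>\<close> lies on the
    segment from \<open>c\<close> to \<open>c'\<close>, at distance \<open>p + \<epsilon>\<close>
    from \<open>c\<close> and \<open>p' + \<epsilon>\<close> from \<open>c'\<close>, thus half-way
    across the gap.\<close>
  define \<epsilon> where "\<epsilon> = (norm d - p - p') / 2"
  define \<tau> where "\<tau> = (p + \<epsilon>) / norm d"
  define \<kappa> where "\<kappa> = c + of_real \<tau> * d"
  \<comment> \<open>A square root, because the rotation that makes \<open>d\<close> a positive real
    acts on \<open>z\<^sup>2\<close>.\<close>
  define \<mu> where "\<mu> = csqrt (of_real (norm d) / d)"
  define \<psi> where "\<psi> z = \<phi> (\<mu> * z) * exp (\<kappa> * (\<mu> * z)\<^sup>2)" for z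
  have \<epsilon>: "\<epsilon> > 0" using c by (simp add: \<epsilon>_def d_def)
  have d0: "norm d > 0" using c assms(2,3) unfolding d_def by linarith
  have \<mu>: "d * \<mu>\<^sup>2 = of_real (norm d)" using d0 by (simp add: \<mu>_def)
  have "norm (\<mu>\<^sup>2) = 1" using d0 by (simp add: \<mu>_def norm_divide)
  then have n\<mu>: "norm \<mu> = 1" by (metis norm_power norm_ge_zero power2_eq_imp_eq one_power2 zero_le_one)
  have \<tau>: "\<tau> * norm d = p + \<epsilon>" using d0 by (simp add: \<tau>_def)
  have hol\<psi>: "\<psi> holomorphic_on UNIV"
    unfolding \<psi>_def by (intro holomorphic_intros holomorphic_on_compose_gen[OF _ hol, unfolded o_def]) auto
  have C: "0 \<le> C" "0 \<le> C'" using order_trans[OF norm_ge_zero b1[of 0]] order_trans[OF norm_ge_zero b2[of 0]] by auto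
  define K where "K = max C C'"
  \<comment> \<open>With \<open>|z|^2 = Re^2 + Im^2\<close> and
    \<open>Re (z^2) = Re^2 - Im^2\<close> the two shifted bounds have growth coefficients
    \<open>2 * p + \<epsilon>\<close> and \<open>2 * p' + \<epsilon>\<close>; this \<open>M\<close>
    dominates both.\<close>
  define M where "M = 2 * p + 2 * p' + \<epsilon>"
  have norm\<psi>: "norm (\<psi> z) = norm (\<phi> (\<mu> * z)) * exp (Re (\<kappa> * (\<mu> * z)\<^sup>2))" for z
    by (simp add: \<psi>_def norm_mult)
  have e: "\<kappa> * (\<mu> * z)\<^sup>2 - c * (\<mu> * z)\<^sup>2 = of_real (p + \<epsilon>) * z\<^sup>2"
      "\<kappa> * (\<mu> * z)\<^sup>2 - c' * (\<mu> * z)\<^sup>2 = - of_real (p' + \<epsilon>) * z\<^sup>2" for z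
  proof -
    have "\<kappa> * (\<mu> * z)\<^sup>2 - c * (\<mu> * z)\<^sup>2 = of_real \<tau> * (d * \<mu>\<^sup>2) * z\<^sup>2"
      by (simp add: \<kappa>_def power_mult_distrib algebra_simps)
    also have "\<dots> = of_real (p + \<epsilon>) * z\<^sup>2" unfolding \<mu> by (simp flip: of_real_mult \<tau>)
    finally show 1: "\<kappa> * (\<mu> * z)\<^sup>2 - c * (\<mu> * z)\<^sup>2 = of_real (p + \<epsilon>) * z\<^sup>2" .
    have "\<kappa> * (\<mu> * z)\<^sup>2 - c' * (\<mu> * z)\<^sup>2 = (\<kappa> * (\<mu> * z)\<^sup>2 - c * (\<mu> * z)\<^sup>2) - (d * \<mu>\<^sup>2) * z\<^sup>2"
      by (simp add: d_def power_mult_distrib algebra_simps)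
    also have "\<dots> = of_real (p + \<epsilon> - norm d) * z\<^sup>2" unfolding \<mu> 1 by (simp add: algebra_simps)
    also have "p + \<epsilon> - norm d = - (p' + \<epsilon>)" by (simp add: \<epsilon>_def field_simps)
    finally show "\<kappa> * (\<mu> * z)\<^sup>2 - c' * (\<mu> * z)\<^sup>2 = - of_real (p' + \<epsilon>) * z\<^sup>2" by simp
  qed
  have \<psi>0: "\<psi> w = 0" for w
  proof (rule entire_eq_0[OF hol\<psi>, of \<epsilon> M K])
    show "\<epsilon> > 0" "M > 0" using \<epsilon> assms by (auto simp: M_def)
    fix z
    have "norm (\<psi> z) \<le> C' * exp (p' * (norm (\<mu> * z))\<^sup>2 - Re (c' * (\<mu> * z)\<^sup>2)) * exp (Re (\<kappa> * (\<mu> * z)\<^sup>2))"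
      unfolding norm\<psi> by (intro mult_right_mono b2) auto
    also have "\<dots> = C' * exp (p' * (norm z)\<^sup>2 + Re (\<kappa> * (\<mu> * z)\<^sup>2 - c' * (\<mu> * z)\<^sup>2))"
      by (simp add: norm_mult n\<mu> mult.assoc flip: exp_add)
    also have "\<dots> = C' * exp ((2 * p' + \<epsilon>) * (Im z)\<^sup>2 - \<epsilon> * (Re z)\<^sup>2)"
      unfolding e by (simp add: cmod_power2 Re_power2 algebra_simps)
    also have "\<dots> \<le> K * exp (M * (Im z)\<^sup>2 - \<epsilon> * (Re z)\<^sup>2)"
      using C assms by (intro mult_mono) (auto simp: K_def M_def intro!: mult_right_mono)
    finally show "norm (\<psi> z) \<le> K * exp (M * (Im z)\<^sup>2 - \<epsilon> * (Re z)\<^sup>2)" .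
    have "norm (\<psi> z) \<le> C * exp (p * (norm (\<mu> * z))\<^sup>2 - Re (c * (\<mu> * z)\<^sup>2)) * exp (Re (\<kappa> * (\<mu> * z)\<^sup>2))"
      unfolding norm\<psi> by (intro mult_right_mono b1) auto
    also have "\<dots> = C * exp (p * (norm z)\<^sup>2 + Re (\<kappa> * (\<mu> * z)\<^sup>2 - c * (\<mu> * z)\<^sup>2))"
      by (simp add: norm_mult n\<mu> mult.assoc flip: exp_add)
    also have "\<dots> = C * exp ((2 * p + \<epsilon>) * (Re z)\<^sup>2 - \<epsilon> * (Im z)\<^sup>2)"
      unfolding e by (simp add: cmod_power2 Re_power2 algebra_simps)
    also have "\<dots> \<le> K * exp (M * (Re z)\<^sup>2 - \<epsilon> * (Im z)\<^sup>2)"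
      using C assms by (intro mult_mono) (auto simp: K_def M_def intro!: mult_right_mono)
    finally show "norm (\<psi> z) \<le> K * exp (M * (Re z)\<^sup>2 - \<epsilon> * (Im z)\<^sup>2)" .
  qed
  have "\<mu> \<noteq> 0" using n\<mu> by auto
  then show ?thesis using \<psi>0[of "z / \<mu>"] by (simp add: \<psi>_def)
qed

section \<open>Uniqueness for the Fourier transform\<close>

text \<open>Integrability is bundled with the vanishing of the transform so that the predicate is
  closed under sums, scalars and multiplication by characters, the last being a shift in
  frequency.\<close>

definition fourier_null :: "('a::euclidean_space \<Rightarrow> complex) \<Rightarrow> bool" where
  "fourier_null w \<longleftrightarrow> integrable lborel w \<and> (\<forall>\<xi>. (LINT x|lborel. w x * exp (\<i> * of_real (\<xi> \<bullet> x))) = 0)"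

lemma integrable_mult_exp_i:
  fixes w :: "'a::euclidean_space \<Rightarrow> complex"
  assumes "integrable lborel w"
  shows "integrable lborel (\<lambda>x. w x * exp (\<i> * of_real (\<xi> \<bullet> x)))"
  using assms by (rule Bochner_Integration.integrable_bound)
    (use assms in \<open>auto simp: norm_mult intro!: borel_measurable_times borel_measurable_continuous_onI continuous_intros\<close>)

lemma fourier_null_cmult:
  assumes "fourier_null w"
  shows "fourier_null (\<lambda>x. w x * c)"
proof -
  have "(LINT x|lborel. w x * c * exp (\<i> * of_real (\<xi> \<bullet> x))) = (LINT x|lborel. w x * exp (\<i> * of_real (\<xi> \<bullet> x))) * c" for \<xi>
    by (subst integral_mult_left_zero[symmetric]) (simp add: mult_ac)
  then show ?thesis using assms by (auto simp: fourier_null_def)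
qed

lemma fourier_null_add:
  assumes "fourier_null v" "fourier_null w"
  shows "fourier_null (\<lambda>x. v x + w x)"
proof -
  have i: "integrable lborel v" "integrable lborel w" using assms by (auto simp: fourier_null_def)
  show ?thesis
    using assms Bochner_Integration.integral_add[OF i[THEN integrable_mult_exp_i]]
    by (simp add: fourier_null_def distrib_right)
qed

lemma fourier_null_sum:
  assumes "\<And>b. b \<in> B \<Longrightarrow> fourier_null (w b)"
  shows "fourier_null (\<lambda>x. \<Sum>b\<in>B. w b x)"
  using assms
  by (induction B rule: infinite_finite_induct) (auto simp: fourier_null_add, simp_all add: fourier_null_def)

lemma fourier_null_exp:
  assumes "fourier_null w"
  shows "fourier_null (\<lambda>x. w x * exp (\<i> * of_real (\<eta> \<bullet> x)))"
proof -
  have e: "w x * exp (\<i> * of_real (\<eta> \<bullet> x)) * exp (\<i> * of_real (\<xi> \<bullet> x)) = w x * exp (\<i> * of_real ((\<eta> + \<xi>) \<bullet> x))" for \<xi> x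
    by (simp add: inner_add_left algebra_simps exp_add)
  show ?thesis using assms integrable_mult_exp_i[of w \<eta>] unfolding fourier_null_def e by blast
qed

lemma fourier_null_sin:
  assumes "fourier_null w"
  shows "fourier_null (\<lambda>x. w x * of_real (sin (\<eta> \<bullet> x)))"
proof -
  have e: "complex_of_real (sin y) = exp (\<i> * of_real y) * (- \<i> / 2) + exp (\<i> * of_real (- y)) * (\<i> / 2)" for y
    by (simp add: sin_of_real[symmetric] sin_exp_eq' field_simps del: sin_of_real)
  have "fourier_null (\<lambda>x. w x * exp (\<i> * of_real (\<eta> \<bullet> x)) * (- \<i> / 2) + w x * exp (\<i> * of_real ((- \<eta>) \<bullet> x)) * (\<i> / 2))"
    by (intro fourier_null_add fourier_null_cmult fourier_null_exp assms)
  also have "(\<lambda>x. w x * exp (\<i> * of_real (\<eta> \<bullet> x)) * (- \<i> / 2) + w x * exp (\<i> * of_real ((- \<eta>) \<bullet> x)) * (\<i> / 2))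
     = (\<lambda>x. w x * of_real (sin (\<eta> \<bullet> x)))"
    unfolding e by (simp add: inner_minus_left algebra_simps)
  finally show ?thesis .
qed

text \<open>\<open>sin_box L\<close> is bounded, converges to the identity as \<open>L\<close> grows, and a polynomial in it is a trigonometric
  polynomial. Hence Stone-Weierstrass can take the place of Fourier inversion.\<close>
definition sin_box :: "real \<Rightarrow> 'a::euclidean_space \<Rightarrow> 'a" where
  "sin_box L x = (\<Sum>b\<in>Basis. (L * sin ((x \<bullet> b) / L)) *\<^sub>R b)"

text \<open>A linear form in \<open>sin_box L x\<close> is a combination of sines of linear forms in
  \<open>x\<close>. Products need the induction to be general in \<open>w\<close>: the hypothesis
  for the second factor is applied to \<open>w\<close> already multiplied by the first.\<close>

lemma fourier_null_polynomial:
  assumes "real_polynomial_function P" "fourier_null w"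
  shows "fourier_null (\<lambda>x. w x * of_real (P (sin_box L x)))"
  using assms
proof (induction arbitrary: w)
  case (linear f)
  note w = linear(2)
  interpret bounded_linear f by fact
  have "f (sin_box L x) = (\<Sum>b\<in>Basis. sin ((b /\<^sub>R L) \<bullet> x) * (L * f b))" for x
    by (simp add: sin_box_def sum scaleR inner_commute divide_inverse mult_ac)
  then have "(\<lambda>x. w x * of_real (f (sin_box L x))) =
      (\<lambda>x. \<Sum>b\<in>Basis. w x * of_real (sin ((b /\<^sub>R L) \<bullet> x)) * of_real (L * f b))"
    by (simp add: sum_distrib_left mult.assoc)
  then show ?case
    by (simp only:) (intro fourier_null_sum fourier_null_cmult fourier_null_sin w)
next
  case (const c)
  then show ?case by (rule fourier_null_cmult)
next
  case (add f g)
  then show ?case by (simp add: distrib_left fourier_null_add)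
next
  case (mult f g)
  show ?case using mult.IH(2)[OF mult.IH(1)[OF mult.prems]] by (simp add: mult.assoc)
qed

lemma norm_sin_box_le: "norm (sin_box L x :: 'a::euclidean_space) \<le> real DIM('a) * \<bar>L\<bar>"
proof -
  have "norm (sin_box L x) \<le> (\<Sum>b\<in>(Basis::'a set). \<bar>L\<bar>)"
    unfolding sin_box_def
    by (rule order_trans[OF norm_sum], rule sum_mono) (simp add: abs_mult mult_left_le)
  then show ?thesis by simp
qed

lemma sin_box_tendsto: "(\<lambda>n. sin_box (real (Suc n)) x) \<longlonglongrightarrow> (x :: 'a::euclidean_space)"
proof -
  have "(\<lambda>n. real (Suc n) * sin (t / real (Suc n))) \<longlonglongrightarrow> t" for t :: real
    by real_asymp
  then have "(\<lambda>n. sin_box (real (Suc n)) x) \<longlonglongrightarrow> (\<Sum>b\<in>Basis. (x \<bullet> b) *\<^sub>R b)"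
    unfolding sin_box_def by (intro tendsto_sum tendsto_scaleR tendsto_const)
  then show ?thesis by (simp add: euclidean_representation)
qed

lemma continuous_on_sin_box: "continuous_on S (sin_box L)"
proof (cases "L = 0")
  case False
  then show ?thesis unfolding sin_box_def by (intro continuous_intros) auto
qed (simp add: sin_box_def)

text \<open>The range of \<open>sin_box L\<close> lies in a compact ball, on which
  \<open>\<phi>\<close> is uniformly close to a polynomial; the error is then controlled by the
  integral of \<open>norm (w x)\<close>.\<close>

lemma fourier_null_integral_sin_box:
  fixes w :: "'a::euclidean_space \<Rightarrow> complex" and \<phi> :: "'a \<Rightarrow> real"
  assumes w: "fourier_null w" and \<phi>: "continuous_on UNIV \<phi>" and b: "\<And>x. \<bar>\<phi> x\<bar> \<le> K"
  shows "(LINT x|lborel. w x * of_real (\<phi> (sin_box L x))) = 0"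
proof -
  have int: "integrable lborel w" using w by (simp add: fourier_null_def)
  then have [measurable]: "w \<in> borel_measurable borel" by auto
  have [measurable]: "sin_box L \<in> borel_measurable borel" "\<phi> \<in> borel_measurable borel"
    by (intro borel_measurable_continuous_onI continuous_on_sin_box \<phi>)+
  have K: "K \<ge> 0" using b[of 0] by linarith
  have int\<phi>: "integrable lborel (\<lambda>x. w x * of_real (\<phi> (sin_box L x)))"
    by (rule Bochner_Integration.integrable_bound[OF integrable_mult_right[OF integrable_norm[OF int], of K]])
      (auto simp: norm_mult mult.commute[of "norm _"] K abs_mult intro!: mult_right_mono b)
  have "norm (LINT x|lborel. w x * of_real (\<phi> (sin_box L x))) \<le> 0 + e" if "e > 0" for e
  proof -
    define I where "I = (LINT x|lborel. norm (w x))"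
    have I: "I \<ge> 0" by (simp add: I_def)
    define d where "d = e / (I + 1)"
    have d: "d > 0" using that I by (simp add: d_def)
    obtain P where P: "real_polynomial_function P" "\<And>y. y \<in> cball 0 (real DIM('a) * \<bar>L\<bar>) \<Longrightarrow> \<bar>\<phi> y - P y\<bar> < d"
      using Stone_Weierstrass_real_polynomial_function[OF compact_cball continuous_on_subset[OF \<phi> subset_UNIV] d]
      by metis
    have N: "fourier_null (\<lambda>x. w x * of_real (P (sin_box L x)))"
      by (rule fourier_null_polynomial[OF P(1) w])
    then have intP: "integrable lborel (\<lambda>x. w x * of_real (P (sin_box L x)))"
      by (simp add: fourier_null_def)
    have "(LINT x|lborel. w x * of_real (P (sin_box L x)) * exp (\<i> * of_real (0 \<bullet> x))) = 0"
      using N unfolding fourier_null_def by blast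
    then have "(LINT x|lborel. w x * of_real (P (sin_box L x))) = 0" by simp
    then have "(LINT x|lborel. w x * of_real (\<phi> (sin_box L x))) =
        (LINT x|lborel. w x * of_real (\<phi> (sin_box L x)) - w x * of_real (P (sin_box L x)))"
      using int\<phi> intP by simp
    also have "norm \<dots> \<le> (LINT x|lborel. d * norm (w x))"
    proof (rule order_trans[OF integral_norm_bound], rule integral_mono)
      fix x :: 'a
      have "\<bar>\<phi> (sin_box L x) - P (sin_box L x)\<bar> \<le> d"
        using P(2)[of "sin_box L x"] norm_sin_box_le[of L x] by (simp add: less_imp_le)
      then show "norm (w x * of_real (\<phi> (sin_box L x)) - w x * of_real (P (sin_box L x))) \<le> d * norm (w x)"
        unfolding right_diff_distrib[symmetric] of_real_diff[symmetric] norm_mult norm_of_real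
        by (subst mult.commute) (rule mult_right_mono, auto)
    qed (use int in \<open>auto intro!: integrable_norm Bochner_Integration.integrable_diff int\<phi> intP\<close>)
    also have "\<dots> = d * I" by (simp add: I_def)
    also have "\<dots> \<le> e" using that I by (simp add: d_def field_simps)
    finally show ?thesis by simp
  qed
  then have "norm (LINT x|lborel. w x * of_real (\<phi> (sin_box L x))) \<le> 0"
    by (rule field_le_epsilon)
  then show ?thesis by simp
qed

text \<open>Dominated convergence along \<open>L = Suc n\<close>, with majorant
  \<open>K * norm (w x)\<close>; this is where boundedness of \<open>\<phi>\<close> on the whole
  space enters.\<close>

lemma fourier_null_integral_bounded_continuous:
  fixes w :: "'a::euclidean_space \<Rightarrow> complex" and \<phi> :: "'a \<Rightarrow> real"
  assumes w: "fourier_null w" and \<phi>: "continuous_on UNIV \<phi>" and b: "\<And>x. \<bar>\<phi> x\<bar> \<le> K"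
  shows "(LINT x|lborel. w x * of_real (\<phi> x)) = 0"
proof -
  have int: "integrable lborel w" using w by (simp add: fourier_null_def)
  then have [measurable]: "w \<in> borel_measurable borel" by auto
  have [measurable]: "sin_box L \<in> borel_measurable borel" "\<phi> \<in> borel_measurable borel" for L
    by (intro borel_measurable_continuous_onI continuous_on_sin_box \<phi>)+
  have "(\<lambda>n. LINT x|lborel. w x * of_real (\<phi> (sin_box (real (Suc n)) x))) \<longlonglongrightarrow> (LINT x|lborel. w x * of_real (\<phi> x))"
  proof (rule integral_dominated_convergence[where w = "\<lambda>x. K * norm (w x)"])
    show "AE x in lborel. (\<lambda>n. w x * of_real (\<phi> (sin_box (real (Suc n)) x))) \<longlonglongrightarrow> w x * of_real (\<phi> x)"
    proof (rule AE_I2)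
      fix x
      have "isCont \<phi> x" using \<phi> by (simp add: continuous_on_eq_continuous_at)
      from isCont_tendsto_compose[OF this sin_box_tendsto]
      show "(\<lambda>n. w x * of_real (\<phi> (sin_box (real (Suc n)) x))) \<longlonglongrightarrow> w x * of_real (\<phi> x)"
        by (intro tendsto_intros)
    qed
    show "AE x in lborel. norm (w x * of_real (\<phi> (sin_box (real (Suc n)) x))) \<le> K * norm (w x)" for n
      using b by (auto simp: norm_mult mult.commute[of "norm _"] intro!: mult_right_mono)
  qed (use int in auto)
  then show ?thesis
    unfolding fourier_null_integral_sin_box[OF w \<phi> b] by (simp add: LIMSEQ_const_iff)
qed

lemma fourier_null_integral_open:
  fixes w :: "'a::euclidean_space \<Rightarrow> complex"
  assumes w: "fourier_null w" and U: "open U"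
  shows "(LINT x:U|lborel. w x) = 0"
\<comment> \<open>\<open>infdist\<close> to the empty set is 0 by convention, so for
  \<open>U = UNIV\<close> the approximations of the indicator used below would vanish
  identically.\<close>
proof (cases "U = UNIV")
  case True
  then show ?thesis
    using fourier_null_integral_bounded_continuous[OF w, of "\<lambda>_. 1" 1] by (simp add: set_lebesgue_integral_def)
next
  case False
  have int: "integrable lborel w" using w by (simp add: fourier_null_def)
  then have [measurable]: "w \<in> borel_measurable borel" by auto
  define \<phi> where "\<phi> n x = min 1 (real n * infdist x (- U))" for n x
  have c: "continuous_on UNIV (\<phi> n)" for n unfolding \<phi>_def by (intro continuous_intros)
  then have [measurable]: "\<phi> n \<in> borel_measurable borel" for n
    by (rule borel_measurable_continuous_onI)
  have b: "\<bar>\<phi> n x\<bar> \<le> 1" for n x by (auto simp: \<phi>_def infdist_nonneg)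
  have [measurable]: "U \<in> sets borel" using U by auto
  have "(\<lambda>n. LINT x|lborel. w x * of_real (\<phi> n x)) \<longlonglongrightarrow> (LINT x|lborel. indicat_real U x *\<^sub>R w x)"
  proof (rule integral_dominated_convergence[where w = "\<lambda>x. norm (w x)"])
    show "AE x in lborel. (\<lambda>n. w x * of_real (\<phi> n x)) \<longlonglongrightarrow> indicat_real U x *\<^sub>R w x"
    proof (rule AE_I2)
      fix x
      have "(\<lambda>n. \<phi> n x) \<longlonglongrightarrow> indicat_real U x"
      proof (cases "x \<in> U")
        case True
        then have "infdist x (- U) > 0"
          using U False by (metis ComplD closed_Compl infdist_pos_not_in_closed Compl_empty_eq double_complement)
        then have "eventually (\<lambda>n. \<phi> n x = 1) sequentially"
          using reals_Archimedean3[of "infdist x (- U)"] unfolding \<phi>_def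
          by (intro eventually_sequentiallyI[of "nat \<lceil>1 / infdist x (- U)\<rceil>"]) (auto simp: field_simps min_def)
        then show ?thesis using True by (simp add: tendsto_eventually)
      qed (simp add: \<phi>_def)
      then have "(\<lambda>n. w x * of_real (\<phi> n x)) \<longlonglongrightarrow> w x * of_real (indicat_real U x)"
        by (intro tendsto_intros)
      then show "(\<lambda>n. w x * of_real (\<phi> n x)) \<longlonglongrightarrow> indicat_real U x *\<^sub>R w x"
        by (simp add: scaleR_conv_of_real mult.commute)
    qed
    show "AE x in lborel. norm (w x * of_real (\<phi> n x)) \<le> norm (w x)" for n
      using b by (auto simp: norm_mult intro!: mult_left_le)
  qed (use int in auto)
  then show ?thesis
    unfolding fourier_null_integral_bounded_continuous[OF w c b] set_lebesgue_integral_def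
    by (simp add: LIMSEQ_const_iff)
qed

text \<open>The Borel sets over which \<open>w\<close> integrates to zero form a Dynkin system. It
  contains the open sets, an intersection-stable generator, hence every Borel set, and a density
  with all integrals zero vanishes almost everywhere.\<close>

lemma fourier_null_AE_eq_0:
  fixes w :: "'a::euclidean_space \<Rightarrow> complex"
  assumes w: "fourier_null w"
  shows "AE x in lborel. w x = 0"
proof -
  have int: "integrable lborel w" using w by (simp add: fourier_null_def)
  have sint: "set_integrable lborel A w" if "A \<in> sets borel" for A
    using int that unfolding set_integrable_def by (intro integrable_mult_indicator) auto
  have "(LINT x:A|lborel. w x) = 0" if "A \<in> sets borel" for A
  proof -
    have eq: "sets borel = sigma_sets UNIV {S::'a set. open S}"
      by (simp add: borel_def)
    have "Int_stable {S::'a set. open S}" by (auto intro!: Int_stableI)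
    moreover have "{S::'a set. open S} \<subseteq> Pow UNIV" by simp
    moreover have "A \<in> sigma_sets UNIV {S. open S}" using that eq by simp
    ultimately show ?thesis
    proof (induction rule: sigma_sets_induct_disjoint)
      case (basic A)
      then show ?case using fourier_null_integral_open[OF w] by simp
    next
      case empty
      then show ?case by (simp add: set_lebesgue_integral_def)
    next
      case (compl A)
      then have A: "A \<in> sets borel" using eq by simp
      have "(LINT x:UNIV|lborel. w x) = (LINT x:A \<union> (UNIV - A)|lborel. w x)" by simp
      also have "\<dots> = (LINT x:A|lborel. w x) + (LINT x:UNIV - A|lborel. w x)"
        using A by (intro set_integral_Un sint) auto
      finally show ?case using compl fourier_null_integral_open[OF w open_UNIV] by simp
    next
      case (union A)
      then have A: "A i \<in> sets borel" for i using eq by auto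
      have "(LINT x:(\<Union>i. A i)|lborel. w x) = (\<Sum>i. (LINT x:(A i)|lborel. w x))"
        using union(1) A by (intro lebesgue_integral_countable_add sint) (auto simp: disjoint_family_on_def)
      then show ?case using union by simp
    qed
  qed
  then show ?thesis using int by (intro sigma_finite_measure.density_zero[OF lborel.sigma_finite_measure_axioms]) auto
qed

section \<open>The generating function of the Hermite polynomials\<close>

text \<open>Repeated differentiation of \<open>f' = (2 x + 2 \<sigma> t) f\<close>. At
  \<open>t = 0\<close> the choice \<open>\<sigma> = -1\<close> gives the Hermite recursion, and
  \<open>\<sigma> = 1\<close> the same recursion with a plus sign, which serves for
  majorants.\<close>

lemma higher_deriv_exp_quadratic:
  fixes x \<sigma> t :: complex
  defines "f \<equiv> \<lambda>t. exp (2 * x * t + \<sigma> * t\<^sup>2)"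
  shows "(deriv ^^ Suc (Suc n)) f t =
    (2 * x + 2 * \<sigma> * t) * (deriv ^^ Suc n) f t + 2 * \<sigma> * of_nat (Suc n) * (deriv ^^ n) f t"
proof -
  have hol: "f holomorphic_on UNIV"
    unfolding f_def by (intro holomorphic_intros)
  have D: "((deriv ^^ n) f has_field_derivative (deriv ^^ Suc n) f t) (at t)" for n t
    using holomorphic_derivI[OF holomorphic_higher_deriv[OF hol open_UNIV] open_UNIV UNIV_I] by simp
  show ?thesis
  proof (induction n arbitrary: t)
    case 0
    have d1: "deriv f = (\<lambda>t. (2 * x + 2 * \<sigma> * t) * f t)"
    proof
      fix t
      show "deriv f t = (2 * x + 2 * \<sigma> * t) * f t"
        unfolding f_def by (intro DERIV_imp_deriv) (auto intro!: derivative_eq_intros simp: algebra_simps)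
    qed
    have "(f has_field_derivative deriv f t) (at t)"
      using D[of 0 t] by simp
    then have "((\<lambda>t. (2 * x + 2 * \<sigma> * t) * f t) has_field_derivative
        (2 * x + 2 * \<sigma> * t) * deriv f t + 2 * \<sigma> * f t) (at t)"
      by (auto intro!: derivative_eq_intros)
    from DERIV_imp_deriv[OF this, folded d1] show ?case
      by simp
  next
    case (Suc n)
    let ?g = "\<lambda>t. (2 * x + 2 * \<sigma> * t) * (deriv ^^ Suc n) f t + 2 * \<sigma> * of_nat (Suc n) * (deriv ^^ n) f t"
    have h: "(?g has_field_derivative
        (2 * x + 2 * \<sigma> * t) * (deriv ^^ Suc (Suc n)) f t + 2 * \<sigma> * (deriv ^^ Suc n) f t
         + 2 * \<sigma> * of_nat (Suc n) * (deriv ^^ Suc n) f t) (at t)"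
      by (rule derivative_eq_intros D refl)+ (simp del: funpow.simps)
    have g: "?g = (deriv ^^ Suc (Suc n)) f"
      by (intro ext Suc.IH[symmetric])
    have "(deriv ^^ Suc (Suc (Suc n))) f t = deriv ?g t"
      unfolding g by simp
    also have "\<dots> = (2 * x + 2 * \<sigma> * t) * (deriv ^^ Suc (Suc n)) f t + 2 * \<sigma> * (deriv ^^ Suc n) f t
         + 2 * \<sigma> * of_nat (Suc n) * (deriv ^^ Suc n) f t"
      by (rule DERIV_imp_deriv[OF h])
    also have "\<dots> = (2 * x + 2 * \<sigma> * t) * (deriv ^^ Suc (Suc n)) f t
        + 2 * \<sigma> * of_nat (Suc (Suc n)) * (deriv ^^ Suc n) f t"
      by (simp add: algebra_simps del: funpow.simps)
    finally show ?case .
  qed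
qed

lemma deriv_exp_quadratic_0:
  fixes x \<sigma> :: complex
  shows "deriv (\<lambda>t. exp (2 * x * t + \<sigma> * t\<^sup>2)) 0 = 2 * x"
  by (intro DERIV_imp_deriv) (auto intro!: derivative_eq_intros)

lemma higher_deriv_hermite_generating:
  "(deriv ^^ k) (\<lambda>t. exp (2 * complex_of_real x * t + (-1) * t\<^sup>2)) 0 = of_real (hermite_poly k x)"
proof (induction k x rule: hermite_poly.induct)
  case (3 k x)
  then show ?case
    unfolding higher_deriv_exp_quadratic by (simp add: algebra_simps)
qed (use deriv_exp_quadratic_0[of _ "-1"] in simp_all)

text \<open>With the sign of \<open>t\<^sup>2\<close> reversed, the recursion of the Taylor coefficients has no cancellation.\<close>
lemma hermite_poly_le_higher_deriv:
  "\<exists>r. (deriv ^^ k) (\<lambda>t. exp (2 * complex_of_real \<bar>x\<bar> * t + 1 * t\<^sup>2)) 0 = of_real r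
     \<and> \<bar>hermite_poly k x\<bar> \<le> r"
proof (induction k x rule: hermite_poly.induct)
  case (2 x)
  then show ?case
    using deriv_exp_quadratic_0[of "complex_of_real \<bar>x\<bar>" 1] by (intro exI[of _ "2 * \<bar>x\<bar>"]) simp
next
  case (3 k x)
  from 3(1) obtain r where r: "(deriv ^^ Suc k) (\<lambda>t. exp (2 * complex_of_real \<bar>x\<bar> * t + 1 * t\<^sup>2)) 0 = of_real r"
    "\<bar>hermite_poly (Suc k) x\<bar> \<le> r"
    by auto
  from 3(2) obtain s where s: "(deriv ^^ k) (\<lambda>t. exp (2 * complex_of_real \<bar>x\<bar> * t + 1 * t\<^sup>2)) 0 = of_real s"
    "\<bar>hermite_poly k x\<bar> \<le> s"
    by auto
  have "\<bar>hermite_poly (Suc (Suc k)) x\<bar> \<le> \<bar>2 * x * hermite_poly (Suc k) x\<bar> + \<bar>2 * real (Suc k) * hermite_poly k x\<bar>"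
    by simp
  also have "\<dots> = 2 * \<bar>x\<bar> * \<bar>hermite_poly (Suc k) x\<bar> + 2 * real (Suc k) * \<bar>hermite_poly k x\<bar>"
    by (simp add: abs_mult)
  also have "\<dots> \<le> 2 * \<bar>x\<bar> * r + 2 * real (Suc k) * s"
    using r s by (intro add_mono mult_left_mono) auto
  finally show ?case
    unfolding higher_deriv_exp_quadratic r s
    by (intro exI[of _ "2 * \<bar>x\<bar> * r + 2 * real (Suc k) * s"]) simp
qed (auto intro!: exI[of _ 1])

lemma sums_hermite_generating:
  fixes t :: complex
  shows "(\<lambda>k. of_real (hermite_poly k x) / fact k * t ^ k) sums exp (2 * of_real x * t - t\<^sup>2)"
proof -
  have "(\<lambda>n. (deriv ^^ n) (\<lambda>t. exp (2 * complex_of_real x * t + (-1) * t\<^sup>2)) 0 / fact n * (t - 0) ^ n) sums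
      exp (2 * complex_of_real x * t + (-1) * t\<^sup>2)"
    by (rule holomorphic_power_series[where r = "norm t + 1"]) (auto intro!: holomorphic_intros)
  then show ?thesis
    unfolding higher_deriv_hermite_generating by simp
qed

text \<open>The absolute values are dominated termwise by the Taylor coefficients for
  \<open>\<sigma> = 1\<close> at \<open>\<bar>x\<bar>\<close>. Compared with the generating function
  itself, this costs only the sign of the quadratic term, so the Gaussian factor of the Hermite
  functions still wins in \<open>x\<close>.\<close>

lemma abs_hermite_generating:
  fixes r x :: real
  assumes "r \<ge> 0"
  shows "summable (\<lambda>k. \<bar>hermite_poly k x\<bar> / fact k * r ^ k)"
    and "(\<Sum>k. \<bar>hermite_poly k x\<bar> / fact k * r ^ k) \<le> exp (2 * \<bar>x\<bar> * r + r\<^sup>2)"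
proof -
  let ?F = "\<lambda>t. exp (2 * complex_of_real \<bar>x\<bar> * t + 1 * t\<^sup>2)"
  obtain d where d: "\<And>k. (deriv ^^ k) ?F 0 = of_real (d k)" "\<And>k. \<bar>hermite_poly k x\<bar> \<le> d k"
    using choice[OF allI, of "\<lambda>k r. (deriv ^^ k) ?F 0 = of_real r \<and> \<bar>hermite_poly k x\<bar> \<le> r"]
      hermite_poly_le_higher_deriv[of _ x] by blast
  have "(\<lambda>n. (deriv ^^ n) ?F 0 / fact n * (of_real r - 0) ^ n) sums ?F (of_real r)"
    by (rule holomorphic_power_series[where r = "r + 1"]) (use assms in \<open>auto intro!: holomorphic_intros\<close>)
  also have "(\<lambda>n. (deriv ^^ n) ?F 0 / fact n * (of_real r - 0) ^ n) = (\<lambda>n. of_real (d n / fact n * r ^ n))"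
    unfolding d by simp
  also have "?F (of_real r) = of_real (exp (2 * \<bar>x\<bar> * r + r\<^sup>2))"
    by (simp flip: exp_of_real)
  finally have S: "(\<lambda>n. d n / fact n * r ^ n) sums exp (2 * \<bar>x\<bar> * r + r\<^sup>2)"
    unfolding sums_of_real_iff .
  have le: "\<bar>hermite_poly k x\<bar> / fact k * r ^ k \<le> d k / fact k * r ^ k" for k
    using d(2)[of k] assms by (intro mult_right_mono divide_right_mono) auto
  show *: "summable (\<lambda>k. \<bar>hermite_poly k x\<bar> / fact k * r ^ k)"
    by (rule summable_comparison_test'[OF sums_summable[OF S], of 0])
      (use le assms in \<open>auto simp: abs_mult\<close>)
  show "(\<Sum>k. \<bar>hermite_poly k x\<bar> / fact k * r ^ k) \<le> exp (2 * \<bar>x\<bar> * r + r\<^sup>2)"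
    unfolding sums_unique[OF S] by (intro suminf_le le * sums_summable[OF S])
qed

section \<open>The Bargmann transform\<close>

lemma integrable_gaussian_1d:
  fixes A :: real
  assumes "A > 0"
  shows "integrable lborel (\<lambda>x::real. exp (- A * x\<^sup>2))"
proof -
  define s where "s = 1 / sqrt (2 * A)"
  have s: "s > 0" using assms by (simp add: s_def)
  have "2 * s\<^sup>2 = 1 / A" using assms by (simp add: s_def power_divide)
  then have "normal_density 0 s x = (1 / sqrt (2 * pi * s\<^sup>2)) * exp (- A * x\<^sup>2)" for x
    using assms by (simp add: normal_density_def)
  then have "normal_density 0 s = (\<lambda>x. (1 / sqrt (2 * pi * s\<^sup>2)) * exp (- A * x\<^sup>2))" by (rule ext)
  with integrable_normal_density[OF s, of 0]
  have "integrable lborel (\<lambda>x. (1 / sqrt (2 * pi * s\<^sup>2)) * exp (- A * x\<^sup>2))" by metis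
  from integrable_mult_right[OF this, of "sqrt (2 * pi * s\<^sup>2)"] show ?thesis using s by simp
qed

lemma integrable_gaussian:
  fixes A :: real
  assumes "A > 0"
  shows "integrable lborel (\<lambda>x::'a::euclidean_space. exp (- A * (norm x)\<^sup>2))"
proof (rule integrableI_bounded)
  have n: "(norm x)\<^sup>2 = (\<Sum>b\<in>Basis. (x \<bullet> b)\<^sup>2)" for x :: 'a
    by (metis (no_types, lifting) euclidean_inner power2_eq_square power2_norm_eq_inner sum.cong)
  have "(\<integral>\<^sup>+x. ennreal (norm (exp (- A * (norm x)\<^sup>2))) \<partial>(lborel::'a measure)) =
      (\<integral>\<^sup>+x. (\<Prod>b\<in>Basis. ennreal (exp (- A * (x \<bullet> b)\<^sup>2))) \<partial>(lborel::'a measure))"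
    unfolding n sum_distrib_left by (simp add: exp_sum prod_ennreal abs_prod)
  also have "\<dots> = (\<Prod>b\<in>(Basis::'a set). \<integral>\<^sup>+x. ennreal (exp (- A * x\<^sup>2)) \<partial>lborel)"
    by (rule nn_integral_lborel_prod) auto
  also have "\<dots> < \<infinity>"
    using integrable_gaussian_1d[OF assms] by (simp add: integrable_iff_bounded ennreal_prod_eq_top less_top power_less_top_ennreal)
  finally show "(\<integral>\<^sup>+x. ennreal (norm (exp (- A * (norm x)\<^sup>2))) \<partial>(lborel::'a measure)) < \<infinity>" .
qed simp

lemma integrable_gaussian_shift:
  fixes v :: "'a::euclidean_space"
  assumes "A > 0"
  shows "integrable lborel (\<lambda>x. exp (- A * (norm x)\<^sup>2 + 2 * (v \<bullet> x)))" (is ?int)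
    and "(LINT x|lborel. exp (- A * (norm x)\<^sup>2 + 2 * (v \<bullet> x)))
      = exp ((norm v)\<^sup>2 / A) * (LINT x|lborel. exp (- A * (norm (x::'a))\<^sup>2))" (is ?eq)
proof -
  have D: "distr lborel borel ((+) (- v /\<^sub>R A)) = (lborel::'a measure)"
    by (rule lborel_distr_plus)
  have e: "exp (- A * (norm x)\<^sup>2 + 2 * (v \<bullet> x)) = exp ((norm v)\<^sup>2 / A) * exp (- A * (norm (- v /\<^sub>R A + x))\<^sup>2)" for x
  proof -
    define w where "w = v /\<^sub>R A"
    have v: "v = A *\<^sub>R w" using assms by (simp add: w_def)
    have "- A * (norm x)\<^sup>2 + 2 * (v \<bullet> x) = (norm v)\<^sup>2 / A + - A * (norm (x - w))\<^sup>2"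
      using assms unfolding v
      by (simp add: power2_norm_eq_inner inner_diff_left inner_diff_right inner_commute
          power2_eq_square[of A] algebra_simps)
    then show ?thesis by (simp add: w_def flip: exp_add)
  qed
  have "integrable (distr lborel borel ((+) (- v /\<^sub>R A))) (\<lambda>x. exp (- A * (norm x)\<^sup>2))"
    unfolding D by (rule integrable_gaussian[OF assms])
  then have "integrable lborel (\<lambda>x. exp (- A * (norm (- v /\<^sub>R A + x))\<^sup>2))"
    by (subst (asm) integrable_distr_eq) auto
  then show ?int unfolding e by (intro integrable_mult_right)
  have "(LINT x|distr lborel borel ((+) (- v /\<^sub>R A)). exp (- A * (norm x)\<^sup>2))
      = (LINT x|lborel. exp (- A * (norm (- v /\<^sub>R A + x))\<^sup>2))"
    by (subst integral_distr) auto
  then show ?eq unfolding e D by simp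
qed

section \<open>Unordered series: integration and holomorphy\<close>

text \<open>Unordered sums suit multi-indices, which have no preferred order. The uniform bound on
  finite sums makes the integrals absolutely summable; an enumeration by natural numbers, hence a
  countable infinite index type, then identifies the sum through the sequential theorem.\<close>

lemma has_sum_integral_dominated:
  fixes g :: "'i::countable \<Rightarrow> 'x \<Rightarrow> complex"
  assumes inf: "infinite (UNIV :: 'i set)"
    and int: "\<And>i. integrable M (g i)" and D: "integrable M D"
    and hs: "\<And>x. ((\<lambda>i. g i x) has_sum G x) UNIV"
    and le: "\<And>F x. finite F \<Longrightarrow> (\<Sum>i\<in>F. norm (g i x)) \<le> D x"
  shows "((\<lambda>i. LINT x|M. g i x) has_sum (LINT x|M. G x)) UNIV"
proof -
  obtain e :: "nat \<Rightarrow> 'i" where e: "bij e"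
    using bij_betw_from_nat_into[OF _ inf] by blast
  have bound: "(\<Sum>i\<in>F. (LINT x|M. norm (g i x))) \<le> (LINT x|M. D x)" if "finite F" for F
  proof -
    have "(\<Sum>i\<in>F. (LINT x|M. norm (g i x))) = (LINT x|M. (\<Sum>i\<in>F. norm (g i x)))"
      using int by (simp add: integrable_norm)
    also have "\<dots> \<le> (LINT x|M. D x)" using int D le[OF that] by (intro integral_mono) auto
    finally show ?thesis .
  qed
  have "(\<lambda>i. LINT x|M. norm (g i x)) summable_on UNIV"
    by (rule nonneg_bdd_above_summable_on) (auto intro!: bdd_aboveI[of _ "LINT x|M. D x"] bound)
  then have s1: "(\<lambda>n. LINT x|M. norm (g (e n) x)) summable_on UNIV"
    using summable_on_reindex_bij_betw[OF e, of "\<lambda>i. LINT x|M. norm (g i x)"] by simp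
  have "(\<lambda>i. norm (LINT x|M. g i x)) summable_on UNIV"
    by (rule nonneg_bdd_above_summable_on)
      (auto intro!: bdd_aboveI[of _ "LINT x|M. D x"] order_trans[OF sum_mono bound] integral_norm_bound)
  then have "(\<lambda>i. LINT x|M. g i x) summable_on UNIV"
    by (rule abs_summable_summable)
  then obtain S where S: "((\<lambda>i. LINT x|M. g i x) has_sum S) UNIV"
    by (auto simp: summable_on_def)
  have hse: "((\<lambda>n. g (e n) x) has_sum G x) UNIV" for x
    using hs[of x] has_sum_reindex_bij_betw[OF e, of "\<lambda>i. g i x"] by simp
  have "(\<lambda>n. LINT x|M. g (e n) x) sums (LINT x|M. (\<Sum>n. g (e n) x))"
  proof (rule sums_integral)
    show "integrable M (g (e n))" for n by (rule int)
    show "AE x in M. summable (\<lambda>n. norm (g (e n) x))"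
    proof (rule AE_I2)
      fix x
      have "(\<lambda>n. norm (g (e n) x)) summable_on UNIV"
        using has_sum_imp_summable[OF hse] by (simp add: summable_on_iff_abs_summable_on_complex)
      then show "summable (\<lambda>n. norm (g (e n) x))"
        by (simp add: summable_on_UNIV_nonneg_real_iff)
    qed
    show "summable (\<lambda>n. LINT x|M. norm (g (e n) x))"
      using s1 by (simp add: summable_on_UNIV_nonneg_real_iff)
  qed
  also have "(\<lambda>x. \<Sum>n. g (e n) x) = G"
    using has_sum_imp_sums[OF hse] by (auto simp: sums_iff)
  finally have 1: "(\<lambda>n. LINT x|M. g (e n) x) sums (LINT x|M. G x)" .
  have "((\<lambda>n. LINT x|M. g (e n) x) has_sum S) UNIV"
    using S has_sum_reindex_bij_betw[OF e, of "\<lambda>i. LINT x|M. g i x"] by simp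
  then have "(\<lambda>n. LINT x|M. g (e n) x) sums S" by (rule has_sum_imp_sums)
  with 1 have "S = (LINT x|M. G x)" by (rule sums_unique2[rotated])
  with S show ?thesis by simp
qed

text \<open>Unordered convergence in the complex numbers is absolute, so convergence at the single
  point \<open>r\<close> yields a Weierstrass majorant on the disc of radius \<open>r\<close>.
  Several indices may share the same exponent \<open>m i\<close>, as multi-indices of equal degree
  do.\<close>

lemma holomorphic_has_sum_monomials:
  fixes a :: "'i \<Rightarrow> complex"
  assumes "\<And>z. ((\<lambda>i. a i * z ^ m i) has_sum \<phi> z) UNIV"
  shows "\<phi> holomorphic_on UNIV"
proof -
  have "\<phi> holomorphic_on ball 0 r" if "r > 0" for r
  proof (rule holomorphic_uniform_limit[THEN conjunct2])
    show "uniform_limit (cball 0 r) (\<lambda>F z. \<Sum>i\<in>F. a i * z ^ m i) \<phi> (finite_subsets_at_top UNIV)"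
    proof -
      have "(\<lambda>i. a i * of_real r ^ m i) summable_on UNIV"
        using assms[of "of_real r"] by (rule has_sum_imp_summable)
      then have "(\<lambda>i. norm (a i) * r ^ m i) summable_on UNIV"
        using that by (simp add: summable_on_iff_abs_summable_on_complex norm_mult norm_power)
      then have "uniform_limit (cball 0 r) (\<lambda>F z. \<Sum>i\<in>F. a i * z ^ m i) (\<lambda>z. \<Sum>\<^sub>\<infinity>i. a i * z ^ m i) (finite_subsets_at_top UNIV)"
        by (intro Weierstrass_m_test_general[where M = "\<lambda>i. norm (a i) * r ^ m i"])
          (auto simp: norm_mult norm_power intro!: mult_left_mono power_mono)
      moreover have "\<phi> = (\<lambda>z. \<Sum>\<^sub>\<infinity>i. a i * z ^ m i)" using infsumI[OF assms] by auto
      ultimately show ?thesis by simp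
    qed
  qed (auto intro!: always_eventually continuous_intros holomorphic_intros)
  then have "\<phi> field_differentiable at z" for z
    by (rule holomorphic_on_imp_differentiable_at[of \<phi> "ball 0 (norm z + 1)"]) (auto intro: add_nonneg_pos)
  then show ?thesis by (auto simp: holomorphic_on_def field_differentiable_at_within)
qed

section \<open>Kernel and Hermite expansion of the Bargmann transform\<close>

text \<open>Scaled so that the kernel is the generating function of the Hermite functions (the usual Bargmann
  variable is \<open>sqrt 2 * z\<close>, up to a constant factor).\<close>
definition bargmann_kernel :: "('n::finite \<Rightarrow> complex) \<Rightarrow> real ^ 'n \<Rightarrow> complex" where
  "bargmann_kernel z x = exp (\<Sum>i\<in>UNIV. 2 * of_real (x $ i) * z i - (z i)\<^sup>2 - of_real ((x $ i)\<^sup>2 / 2))"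

definition bargmann :: "(real ^ 'n::finite \<Rightarrow> complex) \<Rightarrow> ('n \<Rightarrow> complex) \<Rightarrow> complex" where
  "bargmann f z = (LINT x|lborel. f x * bargmann_kernel z x)"

text \<open>The monomial \<open>z ^ \<alpha>\<close> over the factorial of \<open>\<alpha>\<close>,
  times the normalising constants of the Hermite functions, which therefore cancel in the product
  with \<open>hermite_multi \<alpha>\<close>.\<close>

definition bargmann_weight :: "('n::finite \<Rightarrow> nat) \<Rightarrow> ('n \<Rightarrow> complex) \<Rightarrow> complex" where
  "bargmann_weight \<alpha> z =
    (\<Prod>i\<in>UNIV. z i ^ \<alpha> i * of_real (sqrt (2 ^ \<alpha> i * fact (\<alpha> i) * sqrt pi) / fact (\<alpha> i)))"

definition bargmann_majorant :: "('n::finite \<Rightarrow> complex) \<Rightarrow> real ^ 'n \<Rightarrow> real" where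
  "bargmann_majorant z x = exp (\<Sum>i\<in>UNIV. 2 * \<bar>x $ i\<bar> * norm (z i) + (norm (z i))\<^sup>2 - (x $ i)\<^sup>2 / 2)"

text \<open>Homogeneity in the total degree, the same number that determines the eigenvalue of
  \<alpha>.\<close>

lemma bargmann_weight_mult:
  "bargmann_weight \<alpha> (\<lambda>i. c * z i) = c ^ (\<Sum>i\<in>UNIV. \<alpha> i) * bargmann_weight \<alpha> z"
  unfolding bargmann_weight_def power_mult_distrib power_sum prod.distrib[symmetric] mult.assoc ..

lemma bargmann_weight_hermite_multi:
  "bargmann_weight \<alpha> z * of_real (hermite_multi \<alpha> x) =
    (\<Prod>i\<in>UNIV. of_real (hermite_poly (\<alpha> i) (x $ i)) / fact (\<alpha> i) * z i ^ \<alpha> i * of_real (exp (- ((x $ i)\<^sup>2) / 2)))"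
proof -
  have "sqrt (2 ^ k * fact k * sqrt pi) > 0" for k by simp
  then have "sqrt (2 ^ k * fact k * sqrt pi) \<noteq> 0" for k using less_irrefl by metis
  then have e: "z i ^ k * of_real (sqrt (2 ^ k * fact k * sqrt pi) / fact k) * of_real (hermite_fun k y)
      = of_real (hermite_poly k y) / fact k * z i ^ k * of_real (exp (- (y\<^sup>2) / 2))" for i k y
    unfolding hermite_fun_def by (simp del: real_sqrt_eq_zero_cancel_iff real_sqrt_mult)
  show ?thesis
    by (simp only: bargmann_weight_def hermite_multi_def of_real_prod prod.distrib[symmetric] e)
qed

text \<open>A finite set of multi-indices lies in the box spanned by its coordinate projections, and
  the sum over a box factorises.\<close>

lemma sum_prod_le_prod_suminf:
  fixes g :: "'n::finite \<Rightarrow> nat \<Rightarrow> real"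
  assumes "finite F" "\<And>i k. g i k \<ge> 0" "\<And>i. summable (g i)"
  shows "(\<Sum>\<alpha>\<in>F. \<Prod>i\<in>UNIV. g i (\<alpha> i)) \<le> (\<Prod>i\<in>UNIV. \<Sum>k. g i k)"
proof -
  let ?B = "\<lambda>i. (\<lambda>\<alpha>. \<alpha> i) ` F"
  have "(\<Sum>\<alpha>\<in>F. \<Prod>i\<in>UNIV. g i (\<alpha> i)) \<le> (\<Sum>\<alpha>\<in>Pi\<^sub>E UNIV ?B. \<Prod>i\<in>UNIV. g i (\<alpha> i))"
    using assms by (intro sum_mono2 finite_PiE prod_nonneg) auto
  also have "\<dots> = (\<Prod>i\<in>UNIV. \<Sum>k\<in>?B i. g i k)"
    using assms by (intro prod_sum_PiE[symmetric]) auto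
  also have "\<dots> \<le> (\<Prod>i\<in>UNIV. \<Sum>k. g i k)"
    using assms by (intro prod_mono conjI sum_nonneg sum_le_suminf) auto
  finally show ?thesis .
qed

lemma has_sum_prod_abs_summable:
  fixes g :: "'n::finite \<Rightarrow> nat \<Rightarrow> complex"
  assumes "\<And>i. summable (\<lambda>k. norm (g i k))" "\<And>i. g i sums s i"
  shows "((\<lambda>\<alpha>. \<Prod>i\<in>UNIV. g i (\<alpha> i)) has_sum (\<Prod>i\<in>UNIV. s i)) UNIV"
proof -
  have "(\<lambda>\<alpha>. norm (\<Prod>i\<in>UNIV. g i (\<alpha> i))) summable_on UNIV"
  proof (rule nonneg_bdd_above_summable_on)
    show "bdd_above (sum (\<lambda>\<alpha>. norm (\<Prod>i\<in>UNIV. g i (\<alpha> i))) ` {F. F \<subseteq> UNIV \<and> finite F})"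
      using sum_prod_le_prod_suminf[of _ "\<lambda>i k. norm (g i k)"] assms(1)
      by (intro bdd_aboveI[of _ "\<Prod>i\<in>UNIV. \<Sum>k. norm (g i k)"]) (auto simp: prod_norm[symmetric])
  qed auto
  then have sm: "(\<lambda>\<alpha>. \<Prod>i\<in>UNIV. g i (\<alpha> i)) summable_on UNIV"
    by (rule abs_summable_summable)
  have abs: "(\<lambda>k. norm (g i k)) summable_on UNIV" for i
    using assms(1) by (simp add: summable_on_UNIV_nonneg_real_iff)
  have "infsum (g i) UNIV = s i" for i
    using abs_summable_summable[OF abs[of i]] assms(2)[of i]
    by (metis has_sum_imp_sums has_sum_infsum sums_unique2)
  then have "(\<Sum>\<^sub>\<infinity>\<alpha>\<in>Pi\<^sub>E UNIV (\<lambda>_. UNIV). \<Prod>i\<in>UNIV. g i (\<alpha> i)) = (\<Prod>i\<in>UNIV. s i)"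
    by (subst infsum_prod_PiE_abs) (auto simp: abs)
  then show ?thesis using sm by (simp add: has_sum_infsum PiE_UNIV_domain has_sum_iff)
qed

lemma bargmann_kernel_expansion:
  fixes z :: "'n::finite \<Rightarrow> complex"
  shows "((\<lambda>\<alpha>. bargmann_weight \<alpha> z * of_real (hermite_multi \<alpha> x)) has_sum bargmann_kernel z x) UNIV"
    and "finite F \<Longrightarrow> (\<Sum>\<alpha>\<in>F. norm (bargmann_weight \<alpha> z * of_real (hermite_multi \<alpha> x))) \<le> bargmann_majorant z x"
proof -
  define g where "g i k = of_real (hermite_poly k (x $ i)) / fact k * z i ^ k * of_real (exp (- ((x $ i)\<^sup>2) / 2))" for i k
  define h where "h i k = \<bar>hermite_poly k (x $ i)\<bar> / fact k * norm (z i) ^ k" for i k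
  have ng: "norm (g i k) = h i k * exp (- ((x $ i)\<^sup>2) / 2)" for i k
    by (simp add: g_def h_def norm_mult norm_divide norm_power)
  have h: "summable (h i)" "(\<Sum>k. h i k) \<le> exp (2 * \<bar>x $ i\<bar> * norm (z i) + (norm (z i))\<^sup>2)" for i
    unfolding h_def by (rule abs_hermite_generating; simp)+
  have sg: "summable (\<lambda>k. norm (g i k))" for i
    unfolding ng by (rule summable_mult2[OF h(1)])
  have "g i sums (exp (2 * of_real (x $ i) * z i - (z i)\<^sup>2) * of_real (exp (- ((x $ i)\<^sup>2) / 2)))" for i
    unfolding g_def by (intro sums_mult2 sums_hermite_generating)
  from has_sum_prod_abs_summable[OF sg this]
  have "((\<lambda>\<alpha>. bargmann_weight \<alpha> z * of_real (hermite_multi \<alpha> x)) has_sum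
     (\<Prod>i\<in>UNIV. exp (2 * of_real (x $ i) * z i - (z i)\<^sup>2) * of_real (exp (- ((x $ i)\<^sup>2) / 2)))) UNIV"
    unfolding bargmann_weight_hermite_multi by (simp only: g_def)
  also have "(\<Prod>i\<in>UNIV. exp (2 * of_real (x $ i) * z i - (z i)\<^sup>2) * of_real (exp (- ((x $ i)\<^sup>2) / 2)))
     = bargmann_kernel z x"
    unfolding bargmann_kernel_def exp_sum[OF finite]
    by (rule prod.cong) (simp_all flip: exp_of_real exp_add)
  finally show "((\<lambda>\<alpha>. bargmann_weight \<alpha> z * of_real (hermite_multi \<alpha> x)) has_sum bargmann_kernel z x) UNIV" .
  assume F: "finite F"
  have "(\<Sum>\<alpha>\<in>F. norm (bargmann_weight \<alpha> z * of_real (hermite_multi \<alpha> x))) = (\<Sum>\<alpha>\<in>F. \<Prod>i\<in>UNIV. norm (g i (\<alpha> i)))"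
    unfolding bargmann_weight_hermite_multi by (simp only: g_def prod_norm)
  also have "\<dots> \<le> (\<Prod>i\<in>UNIV. \<Sum>k. norm (g i k))"
    by (intro sum_prod_le_prod_suminf F sg) auto
  also have "\<dots> \<le> (\<Prod>i\<in>UNIV. exp (2 * \<bar>x $ i\<bar> * norm (z i) + (norm (z i))\<^sup>2 - (x $ i)\<^sup>2 / 2))"
  proof (intro prod_mono conjI suminf_nonneg sg)
    fix i
    have "(\<Sum>k. norm (g i k)) = (\<Sum>k. h i k) * exp (- ((x $ i)\<^sup>2) / 2)"
      unfolding ng by (rule suminf_mult2[OF h(1), symmetric])
    also have "\<dots> \<le> exp (2 * \<bar>x $ i\<bar> * norm (z i) + (norm (z i))\<^sup>2) * exp (- ((x $ i)\<^sup>2) / 2)"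
      by (intro mult_right_mono h) auto
    finally show "(\<Sum>k. norm (g i k)) \<le> exp (2 * \<bar>x $ i\<bar> * norm (z i) + (norm (z i))\<^sup>2 - (x $ i)\<^sup>2 / 2)"
      by (simp flip: exp_add)
  qed auto
  also have "\<dots> = bargmann_majorant z x"
    by (simp add: bargmann_majorant_def exp_sum)
  finally show "(\<Sum>\<alpha>\<in>F. norm (bargmann_weight \<alpha> z * of_real (hermite_multi \<alpha> x))) \<le> bargmann_majorant z x" .
qed

lemma norm_vec_power2: "(norm (x :: real ^ 'n::finite))\<^sup>2 = (\<Sum>i\<in>UNIV. (x $ i)\<^sup>2)"
  unfolding power2_norm_eq_inner inner_vec_def by (simp add: power2_eq_square)

lemma hermite_fun_measurable [measurable]: "hermite_fun k \<in> borel_measurable borel"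
proof -
  have "continuous_on UNIV (hermite_poly k)"
  proof (induction k rule: induct_nat_012)
    case 0
    have "hermite_poly 0 = (\<lambda>x. 1)" by (rule ext) simp
    then show ?case by simp
  next
    case 1
    have "hermite_poly (Suc 0) = (\<lambda>x. 2 * x)" by (rule ext) simp
    then show ?case by (simp add: continuous_intros)
  next
    case (ge2 k)
    have "hermite_poly (Suc (Suc k)) = (\<lambda>x. 2 * x * hermite_poly (Suc k) x - 2 * real (Suc k) * hermite_poly k x)"
      by (rule ext) simp
    then show ?case using ge2 by (simp only:) (intro continuous_intros)
  qed
  then have [measurable]: "hermite_poly k \<in> borel_measurable borel"
    by (rule borel_measurable_continuous_onI)
  show ?thesis unfolding hermite_fun_def[abs_def] by measurable
qed

lemma borel_measurable_vec_nth' [measurable]: "(\<lambda>x :: real ^ 'n::finite. x $ i) \<in> borel_measurable borel"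
  by (intro borel_measurable_continuous_onI continuous_intros)

lemma hermite_multi_measurable [measurable]: "hermite_multi \<alpha> \<in> borel_measurable borel"
  unfolding hermite_multi_def[abs_def] by measurable

lemma bargmann_kernel_measurable [measurable]: "bargmann_kernel z \<in> borel_measurable borel"
  unfolding bargmann_kernel_def[abs_def] by measurable

lemma bargmann_majorant_measurable [measurable]: "bargmann_majorant z \<in> borel_measurable borel"
  unfolding bargmann_majorant_def[abs_def] by measurable

lemma integrable_norm_mult_majorant:
  fixes f :: "real ^ 'n::finite \<Rightarrow> complex"
  assumes "L2 f"
  shows "integrable lborel (\<lambda>x. norm (f x) * bargmann_majorant z x)"
proof -
  have [measurable]: "f \<in> borel_measurable borel" and f2: "integrable lborel (\<lambda>x. (norm (f x))\<^sup>2)"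
    using assms by (auto simp: L2_def)
  \<comment> \<open>From \<open>(\<bar>x\<bar> - 4 |z|)^2 \<ge> 0\<close> one gets
    \<open>4 \<bar>x\<bar> |z| \<le> x^2 / 2 + 8 |z|^2\<close>; the doubled exponent contributes the
    remaining \<open>2 |z|^2\<close>.\<close>
  define K where "K = exp (\<Sum>i\<in>UNIV. 10 * (norm (z i))\<^sup>2)"
  have maj: "(bargmann_majorant z x)\<^sup>2 \<le> K * exp (- (1/2) * (norm x)\<^sup>2)" for x
  proof -
    have "2 * (2 * \<bar>x $ i\<bar> * norm (z i) + (norm (z i))\<^sup>2 - (x $ i)\<^sup>2 / 2) \<le> 10 * (norm (z i))\<^sup>2 - (1/2) * (x $ i)\<^sup>2" for i
      using sum_squares_ge_zero[of "\<bar>x $ i\<bar> / 2 - 2 * norm (z i)" 0]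
        zero_le_square[of "\<bar>x $ i\<bar> - 4 * norm (z i)"]
      by (simp add: power2_eq_square algebra_simps)
    then have "(\<Sum>i\<in>UNIV. 2 * (2 * \<bar>x $ i\<bar> * norm (z i) + (norm (z i))\<^sup>2 - (x $ i)\<^sup>2 / 2))
       \<le> (\<Sum>i\<in>UNIV. 10 * (norm (z i))\<^sup>2 - (1/2) * (x $ i)\<^sup>2)"
      by (intro sum_mono)
    then show ?thesis
      by (simp add: bargmann_majorant_def K_def norm_vec_power2 sum_subtractf sum_distrib_left sum_negf flip: exp_double exp_add)
  qed
  have "integrable lborel (\<lambda>x::real^'n. (norm (f x))\<^sup>2 + K * exp (- (1/2) * (norm x)\<^sup>2))"
    using f2 integrable_gaussian[of "1/2", where 'a = "real ^ 'n"] by auto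
  then show ?thesis
  proof (rule Bochner_Integration.integrable_bound)
    show "AE x in lborel. norm (norm (f x) * bargmann_majorant z x)
        \<le> norm ((norm (f x))\<^sup>2 + K * exp (- (1/2) * (norm x)\<^sup>2))"
    proof (rule AE_I2)
      fix x
      have "0 \<le> norm (f x) * bargmann_majorant z x" by (simp add: bargmann_majorant_def)
      moreover from this have "norm (f x) * bargmann_majorant z x \<le> (norm (f x))\<^sup>2 + (bargmann_majorant z x)\<^sup>2"
        using sum_squares_bound[of "norm (f x)" "bargmann_majorant z x"] by linarith
      ultimately show "norm (norm (f x) * bargmann_majorant z x)
        \<le> norm ((norm (f x))\<^sup>2 + K * exp (- (1/2) * (norm x)\<^sup>2))"
        using maj[of x] by simp
    qed
  qed measurable
qed

lemma bargmann_has_sum: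
  fixes f :: "real ^ 'n::finite \<Rightarrow> complex"
  assumes "L2 f"
  shows "((\<lambda>\<alpha>. bargmann_weight \<alpha> z * hermite_coeff f \<alpha>) has_sum bargmann f z) UNIV"
proof -
  have [measurable]: "f \<in> borel_measurable borel" using assms by (auto simp: L2_def)
  have inf: "infinite (UNIV :: ('n \<Rightarrow> nat) set)"
    by (rule infinite_super[OF subset_UNIV, of "range (\<lambda>k _. k)"])
      (auto intro!: range_inj_infinite injI simp: fun_eq_iff)
  have 1: "(\<Sum>\<alpha>\<in>F. norm (f x * (bargmann_weight \<alpha> z * of_real (hermite_multi \<alpha> x)))) \<le> norm (f x) * bargmann_majorant z x"
    if "finite F" for F x
    using bargmann_kernel_expansion(2)[OF that, of z x]
    by (simp add: norm_mult[of "f x"] mult_left_mono flip: sum_distrib_left)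
  have "((\<lambda>\<alpha>. LINT x|lborel. f x * (bargmann_weight \<alpha> z * of_real (hermite_multi \<alpha> x))) has_sum
     (LINT x|lborel. f x * bargmann_kernel z x)) UNIV"
  proof (rule has_sum_integral_dominated[OF inf _ integrable_norm_mult_majorant[OF assms, of z] _ 1])
    show "integrable lborel (\<lambda>x. f x * (bargmann_weight \<alpha> z * of_real (hermite_multi \<alpha> x)))" for \<alpha>
      by (rule Bochner_Integration.integrable_bound[OF integrable_norm_mult_majorant[OF assms, of z]])
        (use 1[of "{\<alpha>}"] in \<open>auto simp: bargmann_majorant_def\<close>)
    show "((\<lambda>\<alpha>. f x * (bargmann_weight \<alpha> z * of_real (hermite_multi \<alpha> x))) has_sum f x * bargmann_kernel z x) UNIV" for x
      by (intro has_sum_cmult_right bargmann_kernel_expansion)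
  qed auto
  moreover have "(LINT x|lborel. f x * (bargmann_weight \<alpha> z * of_real (hermite_multi \<alpha> x))) = bargmann_weight \<alpha> z * hermite_coeff f \<alpha>" for \<alpha>
    by (simp add: hermite_coeff_def mult.left_commute[of "f _"])
  ultimately show ?thesis by (simp add: bargmann_def)
qed

lemma integrable_mult_bargmann_kernel:
  fixes f :: "real ^ 'n::finite \<Rightarrow> complex"
  assumes "L2 f"
  shows "integrable lborel (\<lambda>x. f x * bargmann_kernel z x)"
proof (rule Bochner_Integration.integrable_bound[OF integrable_norm_mult_majorant[OF assms, of z]])
  have [measurable]: "f \<in> borel_measurable borel" using assms by (auto simp: L2_def)
  show "(\<lambda>x. f x * bargmann_kernel z x) \<in> borel_measurable lborel" by measurable
  have "2 * x * Re w - Re (w\<^sup>2) \<le> 2 * \<bar>x\<bar> * norm w + (norm w)\<^sup>2" for w x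
  proof -
    have "x * Re w \<le> \<bar>x\<bar> * norm w"
      by (rule order_trans[OF abs_ge_self]) (simp add: abs_mult mult_left_mono abs_Re_le_cmod)
    moreover have "- Re (w\<^sup>2) \<le> (norm w)\<^sup>2" using abs_Re_le_cmod[of "w\<^sup>2"] by (simp add: norm_power)
    ultimately show ?thesis by simp
  qed
  then have "norm (bargmann_kernel z x) \<le> bargmann_majorant z x" for x
    unfolding bargmann_kernel_def bargmann_majorant_def norm_exp_eq_Re
    by (auto intro!: sum_mono)
  then show "AE x in lborel. norm (f x * bargmann_kernel z x) \<le> norm (norm (f x) * bargmann_majorant z x)"
    by (auto simp: norm_mult intro!: mult_left_mono AE_I2 order_trans[OF _ abs_ge_self])
qed

lemma bargmann_holomorphic:
  assumes "L2 f"
  shows "(\<lambda>\<zeta>. bargmann f (\<lambda>i. \<zeta> * \<omega> i)) holomorphic_on UNIV"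
proof (rule holomorphic_has_sum_monomials)
  show "((\<lambda>\<alpha>. (bargmann_weight \<alpha> \<omega> * hermite_coeff f \<alpha>) * \<zeta> ^ (\<Sum>i\<in>UNIV. \<alpha> i)) has_sum bargmann f (\<lambda>i. \<zeta> * \<omega> i)) UNIV" for \<zeta>
    using bargmann_has_sum[OF assms, of "\<lambda>i. \<zeta> * \<omega> i"] by (simp add: bargmann_weight_mult mult_ac)
qed

text \<open>In \<open>exp (-is (2|\<alpha>| + n))\<close> the part with \<open>n\<close> is a common
  constant, and the rest is the power \<open>|\<alpha>|\<close> of \<open>exp (-2is)\<close>, which
  the homogeneity of the weights moves into the variable.\<close>

lemma bargmann_schroedinger:
  fixes f :: "real ^ 'n::finite \<Rightarrow> complex"
  assumes "hermite_schroedinger f u"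
  shows "bargmann (\<lambda>x. u x s) z = exp (- \<i> * of_real (s * real CARD('n))) * bargmann f (\<lambda>i. exp (- \<i> * of_real (2 * s)) * z i)"
proof -
  have L: "L2 f" "L2 (\<lambda>x. u x s)"
    and c: "hermite_coeff (\<lambda>x. u x s) \<alpha> = exp (- \<i> * complex_of_real (s * hermite_eigenvalue \<alpha>)) * hermite_coeff f \<alpha>" for \<alpha>
    using assms by (auto simp: hermite_schroedinger_def)
  have e: "exp (- \<i> * complex_of_real (s * hermite_eigenvalue \<alpha>)) =
      exp (- \<i> * of_real (s * real CARD('n))) * exp (- \<i> * of_real (2 * s)) ^ (\<Sum>i\<in>UNIV. \<alpha> i)" for \<alpha> :: "'n \<Rightarrow> nat"
    unfolding exp_of_nat_mult[symmetric] exp_add[symmetric] hermite_eigenvalue_def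
    by (simp add: algebra_simps)
  have "((\<lambda>\<alpha>. bargmann_weight \<alpha> z * hermite_coeff (\<lambda>x. u x s) \<alpha>) has_sum
     exp (- \<i> * of_real (s * real CARD('n))) * bargmann f (\<lambda>i. exp (- \<i> * of_real (2 * s)) * z i)) UNIV"
    using has_sum_cmult_right[OF bargmann_has_sum[OF L(1), of "\<lambda>i. exp (- \<i> * of_real (2 * s)) * z i"],
      of "exp (- \<i> * of_real (s * real CARD('n)))"]
    unfolding bargmann_weight_mult c e by (simp add: mult_ac)
  with bargmann_has_sum[OF L(2), of z] show ?thesis by (rule has_sum_unique)
qed

section \<open>Growth, vanishing and the uncertainty principle\<close>

lemma norm_bargmann_kernel_line:
  "norm (bargmann_kernel (\<lambda>i. \<zeta> * of_real (\<omega> $ i)) x) =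
     exp (2 * Re \<zeta> * (\<omega> \<bullet> x) - Re (\<zeta>\<^sup>2) * (norm \<omega>)\<^sup>2 - (norm x)\<^sup>2 / 2)"
proof -
  have "Re (\<Sum>i\<in>UNIV. 2 * of_real (x $ i) * (\<zeta> * of_real (\<omega> $ i)) - (\<zeta> * of_real (\<omega> $ i))\<^sup>2 - of_real ((x $ i)\<^sup>2 / 2))
    = (\<Sum>i\<in>UNIV. 2 * Re \<zeta> * (\<omega> $ i * x $ i) - Re (\<zeta>\<^sup>2) * (\<omega> $ i)\<^sup>2 - (x $ i)\<^sup>2 / 2)"
    by (simp add: power_mult_distrib algebra_simps flip: of_real_power)
  also have "\<dots> = 2 * Re \<zeta> * (\<omega> \<bullet> x) - Re (\<zeta>\<^sup>2) * (norm \<omega>)\<^sup>2 - (norm x)\<^sup>2 / 2"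
    by (simp only: sum_subtractf sum_distrib_left[symmetric] sum_divide_distrib[symmetric] norm_vec_power2 inner_vec_def inner_real_def)
  finally show ?thesis by (simp add: bargmann_kernel_def)
qed

text \<open>The exponent comes from completing the square in a Gaussian integral and from
  \<open>2 * (Re \<zeta>)\<^sup>2 = (norm \<zeta>)\<^sup>2 + Re (\<zeta>\<^sup>2)\<close>.\<close>
lemma bargmann_growth:
  fixes f :: "real ^ 'n::finite \<Rightarrow> complex"
  assumes f: "L2 f" and a: "a > 0" and C: "AE x in lborel. norm (f x) \<le> C * exp (- a * (norm x)\<^sup>2)"
    and \<omega>: "norm \<omega> = 1"
  obtains K where "\<And>\<zeta>. norm (bargmann f (\<lambda>i. \<zeta> * of_real (\<omega> $ i)))
    \<le> K * exp (1 / (2 * a + 1) * (norm \<zeta>)\<^sup>2 - 2 * a / (2 * a + 1) * Re (\<zeta>\<^sup>2))"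
proof
  fix \<zeta>
  let ?k = "bargmann_kernel (\<lambda>i. \<zeta> * of_real (\<omega> $ i))"
  \<comment> \<open>The decay rate \<open>a\<close> of \<open>f\<close> plus the rate
    \<open>1 / 2\<close> of the Gaussian built into the kernel.\<close>
  let ?A = "a + 1 / 2"
  let ?G = "\<lambda>x :: real ^ 'n. exp (- ?A * (norm x)\<^sup>2 + 2 * ((Re \<zeta> *\<^sub>R \<omega>) \<bullet> x))"
  have A: "?A > 0" using a by simp
  have "norm (bargmann f (\<lambda>i. \<zeta> * of_real (\<omega> $ i))) \<le> (LINT x|lborel. norm (f x * ?k x))"
    unfolding bargmann_def by (rule integral_norm_bound)
  also have "\<dots> \<le> (LINT x|lborel. C * exp (- Re (\<zeta>\<^sup>2)) * ?G x)"
  proof (rule integral_mono_AE)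
    show "integrable lborel (\<lambda>x. norm (f x * ?k x))"
      by (intro integrable_norm integrable_mult_bargmann_kernel f)
    show "integrable lborel (\<lambda>x. C * exp (- Re (\<zeta>\<^sup>2)) * ?G x)"
      by (intro integrable_mult_right integrable_gaussian_shift A)
    show "AE x in lborel. norm (f x * ?k x) \<le> C * exp (- Re (\<zeta>\<^sup>2)) * ?G x"
      using C
    proof eventually_elim
      case (elim x)
      have "norm (f x * ?k x) \<le> C * exp (- a * (norm x)\<^sup>2) * norm (?k x)"
        unfolding norm_mult by (intro mult_right_mono elim) auto
      also have "\<dots> = C * (exp (- a * (norm x)\<^sup>2) * exp (2 * Re \<zeta> * (\<omega> \<bullet> x) - Re (\<zeta>\<^sup>2) - (norm x)\<^sup>2 / 2))"
        unfolding norm_bargmann_kernel_line \<omega> by simp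
      also have "exp (- a * (norm x)\<^sup>2) * exp (2 * Re \<zeta> * (\<omega> \<bullet> x) - Re (\<zeta>\<^sup>2) - (norm x)\<^sup>2 / 2) = exp (- Re (\<zeta>\<^sup>2)) * ?G x"
        unfolding exp_add[symmetric] by (simp add: algebra_simps)
      finally show ?case by (simp only: mult.assoc)
    qed
  qed
  also have "\<dots> = C * exp (- Re (\<zeta>\<^sup>2)) * (exp ((norm (Re \<zeta> *\<^sub>R \<omega>))\<^sup>2 / ?A) * (LINT x|lborel. exp (- ?A * (norm (x :: real ^ 'n))\<^sup>2)))"
    by (simp only: integral_mult_right_zero integrable_gaussian_shift(2)[OF A])
  also have "\<dots> = C * (LINT x|lborel. exp (- ?A * (norm (x :: real ^ 'n))\<^sup>2)) * exp (- Re (\<zeta>\<^sup>2) + (Re \<zeta>)\<^sup>2 / ?A)"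
    using \<omega> by (simp add: mult_ac flip: exp_add)
  also have "- Re (\<zeta>\<^sup>2) + (Re \<zeta>)\<^sup>2 / ?A = 1 / (2 * a + 1) * (norm \<zeta>)\<^sup>2 - 2 * a / (2 * a + 1) * Re (\<zeta>\<^sup>2)"
    using a by (simp add: cmod_power2 Re_power2 divide_simps) (simp add: algebra_simps)
  finally show "norm (bargmann f (\<lambda>i. \<zeta> * of_real (\<omega> $ i)))
    \<le> C * (LINT x|lborel. exp (- ?A * (norm (x :: real ^ 'n))\<^sup>2)) * exp (1 / (2 * a + 1) * (norm \<zeta>)\<^sup>2 - 2 * a / (2 * a + 1) * Re (\<zeta>\<^sup>2))" .
qed

lemma bargmann_eq_0_imp_AE_eq_0:
  fixes f :: "real ^ 'n::finite \<Rightarrow> complex"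
  assumes f: "L2 f" and z: "\<And>\<omega>. bargmann f (\<lambda>i. \<i> * of_real (\<omega> $ i)) = 0"
  shows "AE x in lborel. f x = 0"
proof -
  \<comment> \<open>The kernel at 0 is the Gaussian \<open>exp (- |x|^2 / 2)\<close>; its product
    with an \<open>L2\<close> function is integrable.\<close>
  define w where "w x = f x * bargmann_kernel (\<lambda>i. 0) x" for x
  have k: "bargmann_kernel (\<lambda>i. \<i> * of_real (\<omega> $ i)) x =
      of_real (exp ((norm \<omega>)\<^sup>2)) * (bargmann_kernel (\<lambda>i. 0) x * exp (\<i> * of_real ((2 *\<^sub>R \<omega>) \<bullet> x)))" for \<omega> x :: "real ^ 'n"
    unfolding bargmann_kernel_def exp_of_real[symmetric] exp_add[symmetric] norm_vec_power2
    by (rule arg_cong[where f = exp])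
      (simp add: inner_vec_def sum_distrib_left power_mult_distrib algebra_simps flip: sum.distrib)
  have "(LINT x|lborel. w x * exp (\<i> * of_real (\<xi> \<bullet> x))) = 0" for \<xi>
  proof -
    \<comment> \<open>At \<open>\<i> \<omega>\<close> the kernel oscillates with frequency
      \<open>2 \<omega>\<close>, hence the evaluation at half of \<xi>.\<close>
    have "0 = (LINT x|lborel. of_real (exp ((norm (\<xi> /\<^sub>R 2))\<^sup>2)) * (w x * exp (\<i> * of_real (\<xi> \<bullet> x))))"
      using z[of "\<xi> /\<^sub>R 2", symmetric] unfolding bargmann_def k w_def by (simp add: mult_ac)
    then show ?thesis by simp
  qed
  then have "fourier_null w"
    unfolding fourier_null_def w_def using integrable_mult_bargmann_kernel[OF f] by blast
  from fourier_null_AE_eq_0[OF this] show ?thesis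
    by eventually_elim (simp add: w_def bargmann_kernel_def)
qed

text \<open>Let \<open>r\<close>, \<open>r'\<close> be the two radii on the right. The centres have
  moduli \<open>p = 1 - r\<close> and \<open>q = 1 - r'\<close>, and their squared distance is
  \<open>(q - p)^2 + 4 p q sin^2 (2 s)\<close>. As \<open>q - p = r - r'\<close>, comparison with
  \<open>(r + r')^2\<close> leaves \<open>p q sin^2 (2 s) > r r'\<close>, and
  \<open>p / r = 2 a\<close>, \<open>q / r' = 2 b\<close> give the hypothesis. Multiplying by
  \<open>D\<close> clears the denominators.\<close>

lemma uncertainty_constant:
  fixes a b s :: real
  assumes "a > 0" "b > 0" and ab: "a * b * (sin (2 * s))\<^sup>2 > 1 / 4"
  shows "norm (2 * b / (2 * b + 1) * exp (\<i> * of_real (4 * s)) - of_real (2 * a / (2 * a + 1)))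
     > 1 / (2 * a + 1) + 1 / (2 * b + 1)"
proof -
  define p where "p = 2 * a / (2 * a + 1)"
  define q where "q = 2 * b / (2 * b + 1)"
  define D where "D = (2 * a + 1) * (2 * b + 1)"
  have D: "D > 0" using assms by (simp add: D_def)
  have pq: "p * D = 2 * a * (2 * b + 1)" "q * D = 2 * b * (2 * a + 1)"
    using assms unfolding D_def p_def q_def by (simp_all add: field_simps)
  have "(1 / x + 1 / y) * (x * y) = x + y" if "x > 0" "y > 0" for x y :: real
    using that by (simp add: field_simps)
  from this[of "2 * a + 1" "2 * b + 1"] assms(1,2)
  have rad: "(1 / (2 * a + 1) + 1 / (2 * b + 1)) * D = 2 * a + 2 * b + 2"
    unfolding D_def by simp
  have c: "cos (4 * s) = 1 - 2 * (sin (2 * s))\<^sup>2"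
    using cos_double_sin[of "2 * s"] by simp
  have "(norm (of_real q * exp (\<i> * of_real (4 * s)) - of_real p))\<^sup>2 = (q * cos (4 * s) - p)\<^sup>2 + (q * sin (4 * s))\<^sup>2"
    by (simp add: cmod_power2 Re_exp Im_exp)
  also have "\<dots> = q\<^sup>2 * ((sin (4 * s))\<^sup>2 + (cos (4 * s))\<^sup>2) - 2 * p * q * cos (4 * s) + p\<^sup>2"
    by algebra
  also have "\<dots> = (q - p)\<^sup>2 + 4 * p * q * (sin (2 * s))\<^sup>2"
    unfolding sin_cos_squared_add unfolding c by (simp add: power2_eq_square algebra_simps)
  finally have n: "(norm (of_real q * exp (\<i> * of_real (4 * s)) - of_real p))\<^sup>2 = (q - p)\<^sup>2 + 4 * p * q * (sin (2 * s))\<^sup>2" .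
  have "((2 * a + 2 * b + 2))\<^sup>2 = (2 * b - 2 * a)\<^sup>2 + 16 * D * (1 / 4)"
    by (simp add: D_def power2_eq_square algebra_simps)
  also have "\<dots> < (2 * b - 2 * a)\<^sup>2 + 16 * D * (a * b * (sin (2 * s))\<^sup>2)"
    using ab D by (intro add_strict_left_mono mult_strict_left_mono) auto
  also have "\<dots> = (q * D - p * D)\<^sup>2 + 4 * (p * D) * (q * D) * (sin (2 * s))\<^sup>2"
    unfolding pq by (simp add: D_def power2_eq_square algebra_simps)
  also have "\<dots> = (norm (of_real q * exp (\<i> * of_real (4 * s)) - of_real p) * D)\<^sup>2"
    unfolding power_mult_distrib n by (simp add: power2_eq_square algebra_simps)
  finally have "2 * a + 2 * b + 2 < norm (of_real q * exp (\<i> * of_real (4 * s)) - of_real p) * D"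
    using D by (intro power2_less_imp_less[of "2 * a + 2 * b + 2"]) auto
  then have "1 / (2 * a + 1) + 1 / (2 * b + 1) < norm (of_real q * exp (\<i> * of_real (4 * s)) - of_real p)"
    unfolding rad[symmetric] using D by simp
  then show ?thesis by (simp add: p_def q_def)
qed

theorem theorem5p2:
  fixes f :: "real ^ 'n::finite \<Rightarrow> complex"
    and u :: "real ^ 'n \<Rightarrow> real \<Rightarrow> complex"
    and a b s0 :: real
  assumes "hermite_schroedinger f u"
    and "a > 0" and "b > 0"
    and "\<exists>C. AE x in lborel. norm (f x) \<le> C * exp (- a * (norm x)\<^sup>2)"
    and "\<exists>C. AE x in lborel. norm (u x s0) \<le> C * exp (- b * (norm x)\<^sup>2)"
    and "a * b * (sin (2 * s0))\<^sup>2 > 1 / 4"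
  shows "\<forall>s. AE x in lborel. u x s = 0"
proof -
  have L: "L2 f" "L2 (\<lambda>x. u x s)" for s
    using assms(1) by (auto simp: hermite_schroedinger_def)
  obtain C1 C2 where C: "AE x in lborel. norm (f x) \<le> C1 * exp (- a * (norm x)\<^sup>2)"
      "AE x in lborel. norm (u x s0) \<le> C2 * exp (- b * (norm x)\<^sup>2)"
    using assms(4,5) by blast
  have unit: "bargmann f (\<lambda>i. \<zeta> * of_real (\<omega> $ i)) = 0" if \<omega>: "norm \<omega> = 1" for \<zeta> and \<omega> :: "real ^ 'n"
  proof -
    define \<phi> where "\<phi> \<zeta> = bargmann f (\<lambda>i. \<zeta> * of_real (\<omega> $ i))" for \<zeta>
    obtain K1 where K1: "\<And>\<zeta>. norm (\<phi> \<zeta>) \<le> K1 * exp (1 / (2 * a + 1) * (norm \<zeta>)\<^sup>2 - 2 * a / (2 * a + 1) * Re (\<zeta>\<^sup>2))"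
      using bargmann_growth[OF L(1) assms(2) C(1) \<omega>] unfolding \<phi>_def by blast
    obtain K2 where K2: "\<And>\<zeta>. norm (bargmann (\<lambda>x. u x s0) (\<lambda>i. \<zeta> * of_real (\<omega> $ i)))
        \<le> K2 * exp (1 / (2 * b + 1) * (norm \<zeta>)\<^sup>2 - 2 * b / (2 * b + 1) * Re (\<zeta>\<^sup>2))"
      using bargmann_growth[OF L(2) assms(3) C(2) \<omega>] by blast
    \<comment> \<open>Undoes the rotation by the evolution: up to a factor of modulus one,
      \<open>\<phi> \<zeta>\<close> is the transform of \<open>u\<close> at time \<open>s0\<close>
      evaluated at \<open>e * \<zeta>\<close>. Its square \<open>e\<^sup>2\<close> turns the centre
      of the second disc.\<close>
    define e where "e = exp (\<i> * of_real (2 * s0))"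
    have "\<phi> \<zeta> = 0"
    proof (rule entire_eq_0_disjoint_discs[of \<phi>])
      show "\<phi> holomorphic_on UNIV" unfolding \<phi>_def by (rule bargmann_holomorphic[OF L(1)])
      show "1 / (2 * a + 1) > 0" "1 / (2 * b + 1) > 0" using assms(2,3) by auto
      have "e\<^sup>2 = exp (\<i> * of_real (4 * s0))" unfolding e_def power2_eq_square exp_add[symmetric] by (simp add: mult_ac)
      then show "norm (of_real (2 * b / (2 * b + 1)) * e\<^sup>2 - of_real (2 * a / (2 * a + 1))) > 1 / (2 * a + 1) + 1 / (2 * b + 1)"
        using uncertainty_constant[OF assms(2,3,6)] by simp
      fix \<zeta>
      show "norm (\<phi> \<zeta>) \<le> K1 * exp (1 / (2 * a + 1) * (norm \<zeta>)\<^sup>2 - Re (of_real (2 * a / (2 * a + 1)) * \<zeta>\<^sup>2))"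
        using K1[of \<zeta>] by simp
      have "bargmann (\<lambda>x. u x s0) (\<lambda>i. (e * \<zeta>) * of_real (\<omega> $ i)) =
          exp (- \<i> * of_real (s0 * real CARD('n))) * \<phi> (exp (- \<i> * of_real (2 * s0)) * (e * \<zeta>))"
        unfolding bargmann_schroedinger[OF assms(1)] \<phi>_def by (simp only: mult.assoc)
      also have "exp (- \<i> * of_real (2 * s0)) * (e * \<zeta>) = \<zeta>"
        by (simp add: e_def exp_minus)
      finally have "norm (\<phi> \<zeta>) = norm (bargmann (\<lambda>x. u x s0) (\<lambda>i. (e * \<zeta>) * of_real (\<omega> $ i)))"
        by (simp add: norm_mult)
      moreover have "norm (e * \<zeta>) = norm \<zeta>" by (simp add: norm_mult e_def)
      ultimately show "norm (\<phi> \<zeta>) \<le> K2 * exp (1 / (2 * b + 1) * (norm \<zeta>)\<^sup>2 - Re (of_real (2 * b / (2 * b + 1)) * e\<^sup>2 * \<zeta>\<^sup>2))"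
        using K2[of "e * \<zeta>"] by (simp only: power_mult_distrib mult.assoc Re_complex_of_real Im_complex_of_real mult_zero_left diff_zero times_complex.sel(1))
    qed
    then show ?thesis by (simp add: \<phi>_def)
  qed
  have zero: "bargmann f (\<lambda>i. \<zeta> * of_real (\<omega> $ i)) = 0" if "\<omega> \<noteq> 0" for \<zeta> and \<omega> :: "real ^ 'n"
  proof -
    have e: "\<zeta> * of_real (norm \<omega>) * of_real ((\<omega> /\<^sub>R norm \<omega>) $ i) = \<zeta> * of_real (\<omega> $ i)" for i
      using that by simp
    have "norm (\<omega> /\<^sub>R norm \<omega>) = 1" using that by simp
    from unit[OF this, of "\<zeta> * of_real (norm \<omega>)"] show ?thesis unfolding e .
  qed
  have zero': "bargmann f (\<lambda>i. \<zeta> * of_real (\<omega> $ i)) = 0" for \<zeta> and \<omega> :: "real ^ 'n"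
  proof (cases "\<omega> = 0")
    case True
    \<comment> \<open>The origin lies on every line, so any nonzero vector with parameter 0
      serves.\<close>
    then show ?thesis using zero[of "axis undefined 1" 0] by (simp add: axis_eq_0_iff)
  qed (rule zero)
  have "AE x in lborel. f x = 0"
    using L(1) zero' by (rule bargmann_eq_0_imp_AE_eq_0)
  \<comment> \<open>The way back to \<open>u\<close>: a vanishing transform at time 0 vanishes at
    all times by the rotation formula, and injectivity applies to each time slice.\<close>
  then have "bargmann f z = 0" for z
    unfolding bargmann_def by (intro integral_eq_zero_AE) auto
  then have "bargmann (\<lambda>x. u x s) z = 0" for s z
    by (simp add: bargmann_schroedinger[OF assms(1)])
  then show ?thesis
    using L(2) by (intro allI bargmann_eq_0_imp_AE_eq_0) auto
qed

end
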